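(* Let $G$ be an algebraic group over a field $K$, let $H\subset G(K)$ be a subgroup, and let $i:H\hookrightarrow G(K)$ be the inclusion. Let $K_s$ be a separable closure of $K$ and let $Z$ be the centralizer of $H$ in $G(K_s)$. Then the pointed set $\mathrm{Emb}_i(H,G(K))$ is canonically isomorphic to the kernel of the natural map of pointed sets $\mathrm{H}^1(K,Z)\rightarrow \mathrm{H}^1(K,G)$.
   Context: Let $\mathfrak{g}=\mathrm{Gal}(K_s/K)$, acting on $G(K_s)$ by $g\mapsto {}^\sigma g$; since $H\subset G(K)$, the centralizer $Z$ is stable under $\mathfrak{g}$. $\mathrm{Emb}_i(H,G(K))$ denotes the set of embeddings (injective group homomorphisms) $H\hookrightarrow G(K)$ which are conjugate to $i$ by an element of $G(K_s)$, modulo conjugacy by elements of $G(K)$; it is pointed by the class of $i$. $\mathrm{H}^1(K,G):=\mathrm{H}^1(\mathfrak{g},G(K_s))$ and $\mathrm{H}^1(K,Z):=\mathrm{H}^1(\mathfrak{g},Z)$ are the (continuous, non-abelian) Galois cohomology pointed sets, with the usual convention: 1-cocycles are continuous maps $\sigma\mapsto a_\sigma$ with $a_{\sigma\tau}=a_\sigma\,{}^\sigma a_\tau$, and $a,a'$ are cohomologous if $a'_\sigma=b^{-1}a_\sigma\,{}^\sigma b$ for some $b$. The kernel of a map of pointed sets is the preimage of the distinguished element. The canonical correspondence is the following: a class in the kernel is represented by a 1-cocycle $\mathfrak g\to Z$ of the form $\sigma\mapsto g^{-1}\,{}^\sigma g$ with $g\in G(K_s)$; to it is associated the class of the embedding $gig^{-1}:h\mapsto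 g\,i(h)\,g^{-1}$. *)

theory Defs
  imports
    "HOL-Algebra.Polynomial_Divisibility"
    "HOL-Algebra.Finite_Extensions"
    "HOL-Algebra.Bij"
    "HOL-Analysis.Abstract_Topology"
begin

section \<open>Separable closures\<close>

text \<open>Polynomials of \<^theory>\<open>HOL-Algebra.Polynomials\<close> are coefficient lists with the leading
  coefficient first, so the derivative lists \<open>i * a\<^sub>i\<close> for \<open>i = n, \<dots>, 1\<close>.\<close>

definition (in ring) formal_deriv :: "'a list \<Rightarrow> 'a list" where
  "formal_deriv p = normalize (map (\<lambda>i. add_pow R i (coeff p i)) (rev [1..<length p]))"

text \<open>A polynomial over \<open>K\<close> is separable if it is coprime to its derivative in \<open>K[X]\<close>.\<close>

definition (in ring) separable_poly :: "'a set \<Rightarrow> 'a list \<Rightarrow> bool" where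
  "separable_poly K p \<longleftrightarrow> p \<in> carrier (K[X]) \<and>
     (\<exists>u \<in> carrier (K[X]). \<exists>v \<in> carrier (K[X]).
        (u \<otimes>\<^bsub>K[X]\<^esub> p) \<oplus>\<^bsub>K[X]\<^esub> (v \<otimes>\<^bsub>K[X]\<^esub> formal_deriv p) = \<one>\<^bsub>K[X]\<^esub>)"

text \<open>The last two assumptions: the minimal polynomial over \<open>K\<close> of every element is separable,
  and \<open>L\<close> is separably closed.\<close>

locale separable_closure = field L + subfield K L for L (structure) and K +
  assumes algebraic_extension: "x \<in> carrier L \<Longrightarrow> (algebraic over K) x"
    and separable_extension: "x \<in> carrier L \<Longrightarrow> separable_poly K (Irr K x)"
    and separably_closed: "P \<in> carrier (poly_ring L) \<Longrightarrow> separable_poly (carrier L) P \<Longrightarrow> splitted P"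

text \<open>The Galois group of \<open>L/K\<close>. As in \<^const>\<open>Bij\<close>, its elements are functions that are
  undefined outside \<open>carrier L\<close>.\<close>

definition galois_group :: "'a ring \<Rightarrow> 'a set \<Rightarrow> ('a \<Rightarrow> 'a) monoid" where
  "galois_group L K =
     BijGroup (carrier L) \<lparr>carrier := {\<sigma> \<in> Bij (carrier L) \<inter> ring_hom L L. \<forall>x\<in>K. \<sigma> x = x}\<rparr>"

text \<open>The Krull topology: the sets below are the cosets \<open>\<sigma> Gal(L/F)\<close>, for \<open>F\<close> running over the
  finite subextensions of \<open>L/K\<close>.\<close>

definition krull_topology :: "'a ring \<Rightarrow> 'a set \<Rightarrow> ('a \<Rightarrow> 'a) topology" where
  "krull_topology L K = topology_generated_by
     {{\<tau> \<in> carrier (galois_group L K). \<forall>x\<in>F. \<tau> x = \<sigma> x} | \<sigma> F.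
        \<sigma> \<in> carrier (galois_group L K) \<and> subfield F L \<and> K \<subseteq> F \<and> ring.finite_dimension L K F}"


section \<open>Commutative algebras over a field\<close>

text \<open>A commutative \<open>k\<close>-algebra \<open>A\<close> is expressed by the library predicate \<^term>\<open>algebra k A\<close>
  (where \<open>A\<close> is automatically commutative, and possibly zero). Morphisms are taken to be undefined
  outside the carrier of their source, so that they are determined by their values on it.\<close>

definition alg_hom ::
  "('k, 'c) ring_scheme \<Rightarrow> ('k, 'u) module \<Rightarrow> ('k, 'u) module \<Rightarrow> ('u \<Rightarrow> 'u) set" where
  "alg_hom k A B = {f \<in> ring_hom A B \<inter> extensional (carrier A).
     \<forall>c\<in>carrier k. \<forall>x\<in>carrier A. f (c \<odot>\<^bsub>A\<^esub> x) = c \<odot>\<^bsub>B\<^esub> f x}"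

definition fin_gen_algebra :: "('k, 'c) ring_scheme \<Rightarrow> ('k, 'u) module \<Rightarrow> bool" where
  "fin_gen_algebra k A \<longleftrightarrow> algebra k A \<and>
     (\<exists>S. finite S \<and> S \<subseteq> carrier A \<and>
       (\<forall>T. subring T A \<and> S \<subseteq> T \<and> (\<forall>c\<in>carrier k. \<forall>x\<in>T. c \<odot>\<^bsub>A\<^esub> x \<in> T) \<longrightarrow> T = carrier A))"

text \<open>The morphism \<open>l : A \<rightarrow> B\<close> exhibits \<open>B\<close> as the localization \<open>A\<^sub>s\<close>.\<close>

definition is_localization ::
  "('k, 'c) ring_scheme \<Rightarrow> ('k, 'u) module \<Rightarrow> 'u \<Rightarrow> ('k, 'u) module \<Rightarrow> ('u \<Rightarrow> 'u) \<Rightarrow> bool" where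
  "is_localization k A s B l \<longleftrightarrow> algebra k B \<and> l \<in> alg_hom k A B \<and> l s \<in> Units B \<and>
     (\<forall>b\<in>carrier B. \<exists>a\<in>carrier A. \<exists>n::nat. b \<otimes>\<^bsub>B\<^esub> (l s [^]\<^bsub>B\<^esub> n) = l a) \<and>
     (\<forall>a\<in>carrier A. l a = \<zero>\<^bsub>B\<^esub> \<longrightarrow> (\<exists>n::nat. (s [^]\<^bsub>A\<^esub> n) \<otimes>\<^bsub>A\<^esub> a = \<zero>\<^bsub>A\<^esub>))"


section \<open>Algebraic groups\<close>

text \<open>An algebraic group over a field \<open>k\<close> is a group scheme of finite type over \<open>k\<close>, presented by
  its functor of points on commutative \<open>k\<close>-algebras, in the style of Demazure and Gabriel: a
  functor to groups whose underlying set-valued functor is a sheaf for the Zariski topology and is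
  covered by finitely many open subfunctors, each represented by a finitely generated
  \<open>k\<close>-algebra. Neither affineness nor smoothness is assumed.

  The algebras range over those with carrier in the type \<open>'u\<close>. Below, \<open>'u\<close> is the type in which a
  separable closure \<open>L\<close> of \<open>k\<close> lives. As \<open>L\<close> is infinite and contains \<open>k\<close>, up to isomorphism
  these include all algebras that are finitely generated over \<open>k\<close> and all their localizations and
  residue fields, and a scheme of finite type is determined by its points in these.\<close>

record ('k, 'u, 'g) alg_functor =
  pts :: "('k, 'u) module \<Rightarrow> 'g monoid"
  fmap :: "('k, 'u) module \<Rightarrow> ('k, 'u) module \<Rightarrow> ('u \<Rightarrow> 'u) \<Rightarrow> 'g \<Rightarrow> 'g"

definition group_functor :: "('k, 'c) ring_scheme \<Rightarrow> ('k, 'u, 'g) alg_functor \<Rightarrow> bool" where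
  "group_functor k G \<longleftrightarrow>
     (\<forall>A. algebra k A \<longrightarrow> group (pts G A)) \<and>
     (\<forall>A B f. algebra k A \<and> algebra k B \<and> f \<in> alg_hom k A B \<longrightarrow>
        fmap G A B f \<in> hom (pts G A) (pts G B)) \<and>
     (\<forall>A. algebra k A \<longrightarrow>
        (\<forall>x\<in>carrier (pts G A). fmap G A A (\<lambda>a\<in>carrier A. a) x = x)) \<and>
     (\<forall>A B C f g. algebra k A \<and> algebra k B \<and> algebra k C \<and>
        f \<in> alg_hom k A B \<and> g \<in> alg_hom k B C \<longrightarrow>
        (\<forall>x\<in>carrier (pts G A).
           fmap G A C (compose (carrier A) g f) x = fmap G B C g (fmap G A B f x)))"

text \<open>Sheaf condition for the covering of \<open>Spec A\<close> by the \<open>Spec A\<^sub>s\<close>, where \<open>s\<close> runs over a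
  finite set \<open>S\<close> generating the unit ideal. Agreement on overlaps is tested in all algebras \<open>C\<close>
  under both \<open>A\<^sub>s\<close> and \<open>A\<^sub>t\<close> over \<open>A\<close>; the universal such \<open>C\<close> is \<open>A\<^sub>s\<^sub>t\<close>.\<close>

definition zariski_sheaf :: "('k, 'c) ring_scheme \<Rightarrow> ('k, 'u, 'g) alg_functor \<Rightarrow> bool" where
  "zariski_sheaf k G \<longleftrightarrow>
     (\<forall>A S B l x. algebra k A \<and> finite S \<and> S \<subseteq> carrier A \<and> Idl\<^bsub>A\<^esub> S = carrier A \<and>
        (\<forall>s\<in>S. is_localization k A s (B s) (l s) \<and> x s \<in> carrier (pts G (B s))) \<and>
        (\<forall>s\<in>S. \<forall>t\<in>S. \<forall>C u v. algebra k C \<and> u \<in> alg_hom k (B s) C \<and> v \<in> alg_hom k (B t) C \<and>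
           compose (carrier A) u (l s) = compose (carrier A) v (l t) \<longrightarrow>
           fmap G (B s) C u (x s) = fmap G (B t) C v (x t)) \<longrightarrow>
        (\<exists>!y. y \<in> carrier (pts G A) \<and> (\<forall>s\<in>S. fmap G A (B s) (l s) y = x s)))"

definition subfunctor ::
  "('k, 'c) ring_scheme \<Rightarrow> ('k, 'u, 'g) alg_functor \<Rightarrow> (('k, 'u) module \<Rightarrow> 'g set) \<Rightarrow> bool" where
  "subfunctor k G U \<longleftrightarrow>
     (\<forall>A. algebra k A \<longrightarrow> U A \<subseteq> carrier (pts G A)) \<and>
     (\<forall>A B f. algebra k A \<and> algebra k B \<and> f \<in> alg_hom k A B \<longrightarrow> fmap G A B f ` U A \<subseteq> U B)"

text \<open>\<open>U\<close> is open if its inverse image along every morphism \<open>Spec A \<rightarrow> G\<close>, i.e. along every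
  \<open>x \<in> G(A)\<close>, is the open subscheme \<open>D(I)\<close> of \<open>Spec A\<close> for some ideal \<open>I\<close> of \<open>A\<close>.\<close>

definition open_subfunctor ::
  "('k, 'c) ring_scheme \<Rightarrow> ('k, 'u, 'g) alg_functor \<Rightarrow> (('k, 'u) module \<Rightarrow> 'g set) \<Rightarrow> bool" where
  "open_subfunctor k G U \<longleftrightarrow> subfunctor k G U \<and>
     (\<forall>A x. algebra k A \<and> x \<in> carrier (pts G A) \<longrightarrow>
        (\<exists>I. ideal I A \<and>
          (\<forall>B f. algebra k B \<and> f \<in> alg_hom k A B \<longrightarrow>
             (fmap G A B f x \<in> U B \<longleftrightarrow> Idl\<^bsub>B\<^esub> (f ` I) = carrier B))))"

text \<open>\<open>U\<close> is represented by a finitely generated algebra \<open>A\<close>, with universal point \<open>\<xi>\<close>.\<close>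

definition affine_fin_type ::
  "('k, 'c) ring_scheme \<Rightarrow> ('k, 'u, 'g) alg_functor \<Rightarrow> (('k, 'u) module \<Rightarrow> 'g set) \<Rightarrow> bool" where
  "affine_fin_type k G U \<longleftrightarrow>
     (\<exists>A \<xi>. fin_gen_algebra k A \<and> \<xi> \<in> U A \<and>
        (\<forall>B. algebra k B \<longrightarrow> bij_betw (\<lambda>f. fmap G A B f \<xi>) (alg_hom k A B) (U B)))"

text \<open>Open subfunctors cover a functor iff they cover its points in every field.\<close>

definition algebraic_group :: "('k, 'c) ring_scheme \<Rightarrow> ('k, 'u, 'g) alg_functor \<Rightarrow> bool" where
  "algebraic_group k G \<longleftrightarrow> field k \<and> group_functor k G \<and> zariski_sheaf k G \<and>
     (\<exists>\<U>. finite \<U> \<and> (\<forall>U\<in>\<U>. open_subfunctor k G U \<and> affine_fin_type k G U) \<and>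
        (\<forall>F. algebra k F \<and> field F \<longrightarrow> carrier (pts G F) = (\<Union>U\<in>\<U>. U F)))"

text \<open>An intermediate ring \<open>K \<subseteq> F \<subseteq> L\<close> as a \<open>K\<close>-algebra. In particular \<open>F = K\<close> and
  \<open>F = carrier L\<close> give the groups \<open>G(K)\<close> and \<open>G(L)\<close>.\<close>

definition ext_algebra :: "'a ring \<Rightarrow> 'a set \<Rightarrow> ('a, 'a) module" where
  "ext_algebra L F = \<lparr>carrier = F, mult = mult L, one = one L, zero = zero L, add = add L,
     smult = mult L\<rparr>"

definition rat_points :: "'a ring \<Rightarrow> 'a set \<Rightarrow> ('a, 'a, 'g) alg_functor \<Rightarrow> 'g monoid" where
  "rat_points L K G = pts G (ext_algebra L K)"

definition sep_points :: "'a ring \<Rightarrow> ('a, 'a, 'g) alg_functor \<Rightarrow> 'g monoid" where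
  "sep_points L G = pts G (ext_algebra L (carrier L))"

text \<open>The canonical map \<open>G(K) \<rightarrow> G(L)\<close>, by which \<open>G(K)\<close> is usually regarded as a subgroup of
  \<open>G(L)\<close>.\<close>

definition rat_to_sep :: "'a ring \<Rightarrow> 'a set \<Rightarrow> ('a, 'a, 'g) alg_functor \<Rightarrow> 'g \<Rightarrow> 'g" where
  "rat_to_sep L K G = fmap G (ext_algebra L K) (ext_algebra L (carrier L)) (\<lambda>x\<in>K. x)"

definition galois_act :: "'a ring \<Rightarrow> ('a, 'a, 'g) alg_functor \<Rightarrow> ('a \<Rightarrow> 'a) \<Rightarrow> 'g \<Rightarrow> 'g" where
  "galois_act L G \<sigma> = fmap G (ext_algebra L (carrier L)) (ext_algebra L (carrier L)) \<sigma>"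


section \<open>Continuous non-abelian cohomology in degree 1\<close>

text \<open>Here \<open>\<Gamma>\<close> is a group with topology \<open>T\<close>, acting by \<open>act\<close> on the discrete group \<open>A\<close>.\<close>

definition cocycles ::
  "('s, 'c) monoid_scheme \<Rightarrow> 's topology \<Rightarrow> ('g, 'd) monoid_scheme \<Rightarrow> ('s \<Rightarrow> 'g \<Rightarrow> 'g) \<Rightarrow>
    ('s \<Rightarrow> 'g) set" where
  "cocycles \<Gamma> T A act = {a \<in> carrier \<Gamma> \<rightarrow>\<^sub>E carrier A.
     continuous_map T (discrete_topology (carrier A)) a \<and>
     (\<forall>\<sigma>\<in>carrier \<Gamma>. \<forall>\<tau>\<in>carrier \<Gamma>. a (\<sigma> \<otimes>\<^bsub>\<Gamma>\<^esub> \<tau>) = a \<sigma> \<otimes>\<^bsub>A\<^esub> act \<sigma> (a \<tau>))}"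

definition cohomologous ::
  "('s, 'c) monoid_scheme \<Rightarrow> 's topology \<Rightarrow> ('g, 'd) monoid_scheme \<Rightarrow> ('s \<Rightarrow> 'g \<Rightarrow> 'g) \<Rightarrow>
    (('s \<Rightarrow> 'g) \<times> ('s \<Rightarrow> 'g)) set" where
  "cohomologous \<Gamma> T A act = {(a, a'). a \<in> cocycles \<Gamma> T A act \<and> a' \<in> cocycles \<Gamma> T A act \<and>
     (\<exists>b\<in>carrier A. \<forall>\<sigma>\<in>carrier \<Gamma>. a' \<sigma> = inv\<^bsub>A\<^esub> b \<otimes>\<^bsub>A\<^esub> a \<sigma> \<otimes>\<^bsub>A\<^esub> act \<sigma> b)}"

definition H1 ::
  "('s, 'c) monoid_scheme \<Rightarrow> 's topology \<Rightarrow> ('g, 'd) monoid_scheme \<Rightarrow> ('s \<Rightarrow> 'g \<Rightarrow> 'g) \<Rightarrow>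
    ('s \<Rightarrow> 'g) set set" where
  "H1 \<Gamma> T A act = cocycles \<Gamma> T A act // cohomologous \<Gamma> T A act"

definition H1_base ::
  "('s, 'c) monoid_scheme \<Rightarrow> 's topology \<Rightarrow> ('g, 'd) monoid_scheme \<Rightarrow> ('s \<Rightarrow> 'g \<Rightarrow> 'g) \<Rightarrow>
    ('s \<Rightarrow> 'g) set" where
  "H1_base \<Gamma> T A act = cohomologous \<Gamma> T A act `` {\<lambda>\<sigma>\<in>carrier \<Gamma>. \<one>\<^bsub>A\<^esub>}"

text \<open>The map to \<open>H1 \<Gamma> T B act\<close> induced by an equivariant homomorphism \<open>f\<close> into \<open>B\<close>.\<close>

definition H1_map ::
  "('s, 'c) monoid_scheme \<Rightarrow> 's topology \<Rightarrow> ('h, 'd) monoid_scheme \<Rightarrow> ('s \<Rightarrow> 'h \<Rightarrow> 'h) \<Rightarrow>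
    ('g \<Rightarrow> 'h) \<Rightarrow> ('s \<Rightarrow> 'g) set \<Rightarrow> ('s \<Rightarrow> 'h) set" where
  "H1_map \<Gamma> T B act f c = cohomologous \<Gamma> T B act `` (compose (carrier \<Gamma>) f ` c)"


section \<open>Embeddings and the kernel\<close>

definition centralizer :: "('g, 'd) monoid_scheme \<Rightarrow> 'g set \<Rightarrow> 'g set" where
  "centralizer G S = {z \<in> carrier G. \<forall>s\<in>S. z \<otimes>\<^bsub>G\<^esub> s = s \<otimes>\<^bsub>G\<^esub> z}"

text \<open>The centralizer \<open>Z\<close> of \<open>H\<close> in \<open>G(L)\<close>, as a group.\<close>

definition cent_group :: "'a ring \<Rightarrow> 'a set \<Rightarrow> ('a, 'a, 'g) alg_functor \<Rightarrow> 'g set \<Rightarrow> 'g monoid" where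
  "cent_group L K G H =
     sep_points L G \<lparr>carrier := centralizer (sep_points L G) (rat_to_sep L K G ` H)\<rparr>"

definition kerH1_base ::
  "'a ring \<Rightarrow> 'a set \<Rightarrow> ('a, 'a, 'g) alg_functor \<Rightarrow> 'g set \<Rightarrow> (('a \<Rightarrow> 'a) \<Rightarrow> 'g) set" where
  "kerH1_base L K G H =
     H1_base (galois_group L K) (krull_topology L K) (cent_group L K G H) (galois_act L G)"

text \<open>The kernel of the map from \<open>H1\<close> of \<open>Z\<close> to \<open>H1\<close> of \<open>G(L)\<close> induced by the inclusion.\<close>

definition kerH1 ::
  "'a ring \<Rightarrow> 'a set \<Rightarrow> ('a, 'a, 'g) alg_functor \<Rightarrow> 'g set \<Rightarrow> (('a \<Rightarrow> 'a) \<Rightarrow> 'g) set set" where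
  "kerH1 L K G H =
     {c \<in> H1 (galois_group L K) (krull_topology L K) (cent_group L K G H) (galois_act L G).
        H1_map (galois_group L K) (krull_topology L K) (sep_points L G) (galois_act L G) (\<lambda>z. z) c =
        H1_base (galois_group L K) (krull_topology L K) (sep_points L G) (galois_act L G)}"

text \<open>The map \<open>\<sigma> \<mapsto> g\<^sup>-\<^sup>1 \<^sup>\<sigma>g\<close>.\<close>

definition coboundary ::
  "'a ring \<Rightarrow> 'a set \<Rightarrow> ('a, 'a, 'g) alg_functor \<Rightarrow> 'g \<Rightarrow> ('a \<Rightarrow> 'a) \<Rightarrow> 'g" where
  "coboundary L K G g = (\<lambda>\<sigma>\<in>carrier (galois_group L K).
     inv\<^bsub>sep_points L G\<^esub> g \<otimes>\<^bsub>sep_points L G\<^esub> galois_act L G \<sigma> g)"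

text \<open>\<open>\<phi>\<close> is the map \<open>g i g\<^sup>-\<^sup>1\<close>, where \<open>i\<close> is the inclusion of \<open>H\<close>; equality holds in
  \<open>G(L)\<close>.\<close>

definition is_conjugate_of_incl ::
  "'a ring \<Rightarrow> 'a set \<Rightarrow> ('a, 'a, 'g) alg_functor \<Rightarrow> 'g set \<Rightarrow> 'g \<Rightarrow> ('g \<Rightarrow> 'g) \<Rightarrow> bool" where
  "is_conjugate_of_incl L K G H g \<phi> \<longleftrightarrow>
     (\<forall>h\<in>H. rat_to_sep L K G (\<phi> h) =
        g \<otimes>\<^bsub>sep_points L G\<^esub> rat_to_sep L K G h \<otimes>\<^bsub>sep_points L G\<^esub> inv\<^bsub>sep_points L G\<^esub> g)"

definition conj_embeddings ::
  "'a ring \<Rightarrow> 'a set \<Rightarrow> ('a, 'a, 'g) alg_functor \<Rightarrow> 'g set \<Rightarrow> ('g \<Rightarrow> 'g) set" where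
  "conj_embeddings L K G H =
     {\<phi> \<in> hom (rat_points L K G \<lparr>carrier := H\<rparr>) (rat_points L K G) \<inter> extensional H.
        inj_on \<phi> H \<and> (\<exists>g\<in>carrier (sep_points L G). is_conjugate_of_incl L K G H g \<phi>)}"

definition rat_conj ::
  "'a ring \<Rightarrow> 'a set \<Rightarrow> ('a, 'a, 'g) alg_functor \<Rightarrow> 'g set \<Rightarrow> (('g \<Rightarrow> 'g) \<times> ('g \<Rightarrow> 'g)) set" where
  "rat_conj L K G H =
     {(\<phi>, \<psi>). \<phi> \<in> conj_embeddings L K G H \<and> \<psi> \<in> conj_embeddings L K G H \<and>
        (\<exists>g\<in>carrier (rat_points L K G). \<forall>h\<in>H.
           \<psi> h = g \<otimes>\<^bsub>rat_points L K G\<^esub> \<phi> h \<otimes>\<^bsub>rat_points L K G\<^esub> inv\<^bsub>rat_points L K G\<^esub> g)}"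

definition Emb ::
  "'a ring \<Rightarrow> 'a set \<Rightarrow> ('a, 'a, 'g) alg_functor \<Rightarrow> 'g set \<Rightarrow> ('g \<Rightarrow> 'g) set set" where
  "Emb L K G H = conj_embeddings L K G H // rat_conj L K G H"

definition Emb_base ::
  "'a ring \<Rightarrow> 'a set \<Rightarrow> ('a, 'a, 'g) alg_functor \<Rightarrow> 'g set \<Rightarrow> ('g \<Rightarrow> 'g) set" where
  "Emb_base L K G H = rat_conj L K G H `` {\<lambda>h\<in>H. h}"

definition pointed_iso :: "('x \<Rightarrow> 'y) \<Rightarrow> 'x set \<Rightarrow> 'x \<Rightarrow> 'y set \<Rightarrow> 'y \<Rightarrow> bool" where
  "pointed_iso f P p Q q \<longleftrightarrow> p \<in> P \<and> q \<in> Q \<and> bij_betw f P Q \<and> f p = q"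

end

theory Submission
  imports Defs
begin

text \<open>
  Write \<open>L\<close> for the separable closure. Call \<open>g \<in> G(L)\<close> a twist if \<open>g\<^sup>-\<^sup>1 \<sigma>g\<close> lies in \<open>Z\<close> for all \<open>\<sigma>\<close>.
  This says that every \<open>g h g\<^sup>-\<^sup>1\<close> with \<open>h \<in> H\<close> is Galois invariant, that is, that conjugation by \<open>g\<close>
  carries \<open>H\<close> into \<open>G(K)\<close>. Hence the embeddings conjugate to the inclusion are the maps \<open>g i g\<^sup>-\<^sup>1\<close> for
  twists \<open>g\<close>. On the other side, a \<open>Z\<close>-cocycle that becomes trivial in \<open>G(L)\<close> is a coboundary
  \<open>\<sigma> \<mapsto> g\<^sup>-\<^sup>1 \<sigma>g\<close>, again of a twist. Two twists \<open>g\<close> and \<open>g'\<close> have cohomologous \<open>Z\<close>-cocycles iff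
  \<open>g' = k g z\<close> for some \<open>k \<in> G(K)\<close> and \<open>z \<in> Z\<close> (\<open>cohZ_cob_iff\<close>), and the same condition expresses that
  their embeddings are conjugate under \<open>G(K)\<close> (\<open>rat_conj_iff\<close>). So both pointed sets are the quotient
  of the set of twists by one and the same relation, and \<open>unique_bijection_through\<close> concludes.

  This uses three properties of an algebraic group: the map from \<open>G(K)\<close> to \<open>G(L)\<close> is injective
  (\<open>r_inj\<close>), its image consists of all Galois invariant points (\<open>fixed_points_rational\<close>), and for each
  \<open>g\<close> the map \<open>\<sigma> \<mapsto> \<sigma>g\<close> is locally constant (\<open>orbit_map_locally_constant\<close>), so that coboundaries are
  continuous. Each is verified in an affine chart around the point, where points are homomorphisms
  from a finitely generated algebra.

  The second property rests on the equality of \<open>K\<close> with the fixed field of the Galois group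
  (\<open>fixed_field_of_automorphisms\<close>). An element outside \<open>K\<close> has a minimal polynomial of degree at least
  2, which splits in \<open>L\<close> with distinct roots, so some \<open>K\<close>-embedding of the generated subfield into \<open>L\<close>
  moves it; by Zorn's lemma this embedding extends to an automorphism of \<open>L\<close>.
\<close>

section \<open>Repeated roots and the formal derivative\<close>

text \<open>The value at \<open>x\<close> of the derivative of \<open>p\<close>. It is computed by recursion on the coefficient list,
  without trimming leading zeros, because the operations on polynomials are recursive in this way
  and a vanishing leading coefficient must be harmless in the inductions below. The truncated
  exponent for a constant term does not matter, as that summand is \<open>0\<close> times the term.\<close>

fun (in ring) deriv_eval :: "'a list \<Rightarrow> 'a \<Rightarrow> 'a" where
  "deriv_eval [] x = \<zero>"
| "deriv_eval (a # p) x = add_pow R (length p) a \<otimes> x [^] (length p - 1) \<oplus> deriv_eval p x"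

context cring
begin

lemma deriv_eval_closed [simp, intro]:
  assumes "set p \<subseteq> carrier R" "x \<in> carrier R"
  shows "deriv_eval p x \<in> carrier R"
  using assms by (induct p) auto

lemma eval_formal_deriv:
  assumes "set p \<subseteq> carrier R" "x \<in> carrier R"
  shows "eval (formal_deriv p) x = deriv_eval p x"
proof -
  let ?d = "\<lambda>p. map (\<lambda>i. add_pow R i (coeff p i)) (rev [1..<length p])"
  have d_carrier: "set (?d p) \<subseteq> carrier R"
    using assms(1) coeff_in_carrier[OF assms(1)] by auto
  have "eval (?d p) x = deriv_eval p x"
    using assms(1)
  proof (induct p)
    case Nil
    show ?case by simp
  next
    case (Cons a p)
    show ?case
    proof (cases p)
      case Nil
      then show ?thesis using Cons(2) assms(2) by simp
    next
      case p: (Cons b q)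
      have "?d (a # p) = add_pow R (length p) a # ?d p"
        using p by (auto simp add: p)
      moreover have "length (?d p) = length p - 1"
        by simp
      ultimately have "eval (?d (a # p)) x
          = add_pow R (length p) a \<otimes> x [^] (length p - 1) \<oplus> eval (?d p) x"
        by (simp del: coeff.simps)
      then show ?thesis
        using Cons by simp
    qed
  qed
  then show ?thesis
    unfolding formal_deriv_def using eval_normalize[OF d_carrier assms(2)] by simp
qed

lemma deriv_eval_normalize:
  assumes "set p \<subseteq> carrier R" "x \<in> carrier R"
  shows "deriv_eval (normalize p) x = deriv_eval p x"
  using assms(1)
proof (induct p)
  case Nil
  show ?case by simp
next
  case (Cons a p)
  then have "deriv_eval p x \<in> carrier R"
    using assms(2) by auto
  then show ?case
    using Cons assms(2) by (cases "a = \<zero>") simp_all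
qed

lemma deriv_eval_replicate:
  assumes "set p \<subseteq> carrier R" "x \<in> carrier R"
  shows "deriv_eval (replicate n \<zero> @ p) x = deriv_eval p x"
  using assms by (induct n) auto

lemma deriv_eval_map2_add:
  assumes "set p \<subseteq> carrier R" "set q \<subseteq> carrier R" "length p = length q" "x \<in> carrier R"
  shows "deriv_eval (map2 (\<oplus>) p q) x = deriv_eval p x \<oplus> deriv_eval q x"
  using assms(3,1,2)
proof (induct p q rule: list_induct2)
  case Nil
  then show ?case by simp
next
  case (Cons a p b q)
  then have "a \<in> carrier R" "b \<in> carrier R" "deriv_eval p x \<in> carrier R" "deriv_eval q x \<in> carrier R"
    "deriv_eval (map2 (\<oplus>) p q) x = deriv_eval p x \<oplus> deriv_eval q x"
    using assms(4) by auto
  then show ?case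
    using Cons(1) assms(4)
    by (simp add: add.nat_pow_distrib l_distr a_ac)
qed

lemma map2_add_carrier:
  assumes "set p \<subseteq> carrier R" "set q \<subseteq> carrier R"
  shows "set (map2 (\<oplus>) p q) \<subseteq> carrier R"
  using assms by (auto dest!: subsetD elim!: in_set_zipE)

lemma deriv_eval_poly_add:
  assumes "set p \<subseteq> carrier R" "set q \<subseteq> carrier R" "x \<in> carrier R"
  shows "deriv_eval (poly_add p q) x = deriv_eval p x \<oplus> deriv_eval q x"
proof -
  have aux: "deriv_eval (poly_add p q) x = deriv_eval p x \<oplus> deriv_eval q x"
    if "set p \<subseteq> carrier R" "set q \<subseteq> carrier R" "length q \<le> length p" for p q
  proof -
    let ?q = "replicate (length p - length q) \<zero> @ q"
    have q: "set ?q \<subseteq> carrier R" "length p = length ?q"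
      using that by auto
    have "poly_add p q = normalize (map2 (\<oplus>) p ?q)"
      using that(3) by simp
    then show ?thesis
      using deriv_eval_normalize[OF map2_add_carrier[OF that(1) q(1)] assms(3)]
        deriv_eval_map2_add[OF that(1) q assms(3)] deriv_eval_replicate[OF that(2) assms(3)]
      by presburger
  qed
  show ?thesis
  proof (cases "length q \<le> length p")
    case True
    then show ?thesis using aux assms by blast
  next
    case False
    then have "poly_add p q = poly_add q p" by auto
    then show ?thesis
      using aux[OF assms(2,1)] False assms a_comm[OF deriv_eval_closed deriv_eval_closed]
      by (metis nat_le_linear)
  qed
qed

lemma deriv_eval_smult:
  assumes "c \<in> carrier R" "set p \<subseteq> carrier R" "x \<in> carrier R"
  shows "deriv_eval (map ((\<otimes>) c) p) x = c \<otimes> deriv_eval p x"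
  using assms(2)
proof (induct p)
  case Nil
  then show ?case using assms by simp
next
  case (Cons a p)
  then have "a \<in> carrier R" "deriv_eval p x \<in> carrier R"
    using assms by auto
  then show ?case
    using Cons assms add_pow_rdistr[of c a "length p"] by (simp add: r_distr m_assoc[symmetric])
qed

lemma deriv_eval_append_zero:
  assumes "set p \<subseteq> carrier R" "x \<in> carrier R"
  shows "deriv_eval (p @ [\<zero>]) x = x \<otimes> deriv_eval p x \<oplus> eval p x"
  using assms(1)
proof (induct p)
  case Nil
  then show ?case using assms by simp
next
  case (Cons a p)
  then have a: "a \<in> carrier R" "deriv_eval p x \<in> carrier R" "eval p x \<in> carrier R"
    using assms eval_in_carrier by auto
  have *: "add_pow R (length p) a \<otimes> x [^] length p
     = x \<otimes> (add_pow R (length p) a \<otimes> x [^] (length p - 1))"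
  proof (cases "length p")
    case 0
    then show ?thesis using a assms by simp
  next
    case (Suc n)
    then show ?thesis using a assms by (simp add: m_ac del: add.nat_pow_Suc)
  qed
  have "deriv_eval ((a # p) @ [\<zero>]) x
    = (add_pow R (length p) a \<oplus> a) \<otimes> x [^] length p \<oplus> (x \<otimes> deriv_eval p x \<oplus> eval p x)"
    using Cons by simp
  also have "\<dots> = x \<otimes> (add_pow R (length p) a \<otimes> x [^] (length p - 1)) \<oplus> a \<otimes> x [^] length p
     \<oplus> (x \<otimes> deriv_eval p x \<oplus> eval p x)"
    using a assms by (simp add: l_distr *)
  also have "\<dots> = x \<otimes> deriv_eval (a # p) x \<oplus> eval (a # p) x"
    using a assms by (simp add: r_distr a_ac)
  finally show ?case .
qed

text \<open>The product rule at a zero of the first factor: the summand containing \<open>eval [\<one>, \<ominus> x] x = \<zero>\<close>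
  drops out. Concretely, multiplication by \<open>X - x\<close> is a shift plus a scalar multiple, and the shift
  contributes \<open>eval q x\<close> besides the two terms that cancel.\<close>

lemma deriv_eval_linear_factor:
  assumes "set q \<subseteq> carrier R" "x \<in> carrier R"
  shows "deriv_eval (poly_mult [\<one>, \<ominus> x] q) x = eval q x"
proof -
  have m1: "set (map ((\<otimes>) \<one>) q) \<subseteq> carrier R" and m2: "set (map ((\<otimes>) (\<ominus> x)) q) \<subseteq> carrier R"
    using assms by auto
  have m1': "map ((\<otimes>) \<one>) q = q"
    using assms(1) by (induct q) auto
  have D: "deriv_eval q x \<in> carrier R" and E: "eval q x \<in> carrier R"
    using assms eval_in_carrier by auto
  have "poly_mult [\<one>, \<ominus> x] q = poly_add (q @ [\<zero>]) (poly_add (map ((\<otimes>) (\<ominus> x)) q) [])"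
    using m1' by (simp del: poly_add.simps)
  then have "deriv_eval (poly_mult [\<one>, \<ominus> x] q) x =
      deriv_eval (q @ [\<zero>]) x \<oplus> (deriv_eval (map ((\<otimes>) (\<ominus> x)) q) x \<oplus> \<zero>)"
    using deriv_eval_poly_add[of "q @ [\<zero>]" "poly_add (map ((\<otimes>) (\<ominus> x)) q) []" x]
      deriv_eval_poly_add[OF m2, of "[]" x] poly_add_in_carrier[OF m2, of "[]"] assms
    by (simp del: poly_add.simps)
  also have "\<dots> = (x \<otimes> deriv_eval q x \<oplus> eval q x) \<oplus> (\<ominus> x \<otimes> deriv_eval q x \<oplus> \<zero>)"
    using deriv_eval_append_zero[OF assms] deriv_eval_smult[OF _ assms, of "\<ominus> x"] assms(2) by simp
  also have "\<dots> = eval q x"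
    using D E assms(2) by algebra
  finally show ?thesis .
qed

end

lemma (in domain) formal_deriv_repeated_root:
  assumes "x \<in> carrier R" "q \<in> carrier (poly_ring R)"
    and "p = [\<one>, \<ominus> x] \<otimes>\<^bsub>poly_ring R\<^esub> ([\<one>, \<ominus> x] \<otimes>\<^bsub>poly_ring R\<^esub> q)"
  shows "eval p x = \<zero>" "eval (formal_deriv p) x = \<zero>"
proof -
  interpret UP: domain "poly_ring R"
    using univ_poly_is_domain[OF carrier_is_subring] .
  let ?l = "[\<one>, \<ominus> x]"
  have l: "?l \<in> carrier (poly_ring R)"
    using assms(1) unfolding sym[OF univ_poly_carrier] polynomial_def by auto
  define r where "r = ?l \<otimes>\<^bsub>poly_ring R\<^esub> q"
  have r: "r \<in> carrier (poly_ring R)" and p: "p \<in> carrier (poly_ring R)"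
    using l assms by (auto simp: r_def)
  then have sets: "set r \<subseteq> carrier R" "set p \<subseteq> carrier R" "set q \<subseteq> carrier R" "set ?l \<subseteq> carrier R"
    using assms(1,2) polynomial_incl unfolding sym[OF univ_poly_carrier] by auto
  have l0: "eval ?l x = \<zero>"
    using assms(1) by (simp, algebra)
  have r0: "eval r x = \<zero>"
    using eval_poly_mult[OF sets(4,3) assms(1)] l0 eval_in_carrier[OF sets(3) assms(1)]
    unfolding r_def univ_poly_mult by simp
  have pr: "p = poly_mult ?l r"
    using assms(3) unfolding r_def univ_poly_mult by simp
  then show "eval p x = \<zero>"
    using eval_poly_mult[OF sets(4,1) assms(1)] l0 r0 by simp
  show "eval (formal_deriv p) x = \<zero>"
    using eval_formal_deriv[OF sets(2) assms(1)] deriv_eval_linear_factor[OF sets(1) assms(1)] pr r0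
    by simp
qed

text \<open>At a double root both \<open>p\<close> and its derivative vanish, which contradicts a relation
  \<open>u p + v p' = 1\<close>.\<close>

lemma (in domain) separable_poly_alg_mult:
  assumes "separable_poly (carrier R) p" "x \<in> carrier R"
  shows "alg_mult p x \<le> 1"
proof (rule ccontr)
  interpret UP: domain "poly_ring R"
    using univ_poly_is_domain[OF carrier_is_subring] .
  assume "\<not> alg_mult p x \<le> 1"
  then have 2: "2 \<le> alg_mult p x" by simp
  from assms(1) obtain u v where p: "p \<in> carrier (poly_ring R)"
    and u: "u \<in> carrier (poly_ring R)" and v: "v \<in> carrier (poly_ring R)"
    and uv: "(u \<otimes>\<^bsub>poly_ring R\<^esub> p) \<oplus>\<^bsub>poly_ring R\<^esub> (v \<otimes>\<^bsub>poly_ring R\<^esub> formal_deriv p) = \<one>\<^bsub>poly_ring R\<^esub>"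
    unfolding separable_poly_def by blast
  let ?l = "[\<one>, \<ominus> x]"
  have l: "?l \<in> carrier (poly_ring R)"
    using assms(2) unfolding sym[OF univ_poly_carrier] polynomial_def by auto
  have "(?l [^]\<^bsub>poly_ring R\<^esub> (2::nat)) pdivides p"
    using le_alg_mult_imp_pdivides[OF assms(2) p 2] .
  then obtain q where q: "q \<in> carrier (poly_ring R)"
    and "p = (?l [^]\<^bsub>poly_ring R\<^esub> (2::nat)) \<otimes>\<^bsub>poly_ring R\<^esub> q"
    unfolding pdivides_def by auto
  then have pq: "p = ?l \<otimes>\<^bsub>poly_ring R\<^esub> (?l \<otimes>\<^bsub>poly_ring R\<^esub> q)"
    using l by (simp add: numeral_2_eq_2 UP.m_assoc)
  have p': "formal_deriv p \<in> carrier (poly_ring R)"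
    unfolding formal_deriv_def sym[OF univ_poly_carrier]
    using p polynomial_incl coeff_in_carrier[of p]
    by (intro normalize_gives_polynomial) (auto simp: sym[OF univ_poly_carrier])
  note hom = ring_hom_memE[OF eval_is_hom[OF carrier_is_subring assms(2)]]
  have "eval \<one>\<^bsub>poly_ring R\<^esub> x
    = eval u x \<otimes> eval p x \<oplus> eval v x \<otimes> eval (formal_deriv p) x"
    unfolding uv[symmetric] using hom u v p p' by simp
  also have "\<dots> = \<zero>"
    using formal_deriv_repeated_root[OF assms(2) q pq] hom(1)[OF u] hom(1)[OF v] by simp
  finally show False
    using hom(4) one_not_zero by simp
qed

text \<open>Separability turns the multiset of roots, whose size is the degree, into a set. This supplies the
  conjugates: a minimal polynomial of degree at least 2 has a second root.\<close>

lemma (in field) card_roots_separable_splitted: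
  assumes "separable_poly (carrier R) p" "splitted p" "p \<noteq> []"
  shows "card {x \<in> carrier R. eval p x = \<zero>} = degree p"
proof -
  have p: "p \<in> carrier (poly_ring R)"
    using assms(1) by (simp add: separable_poly_def)
  have "roots p = mset_set {x \<in> carrier R. eval p x = \<zero>}"
  proof -
    have le1: "count (roots p) x \<le> 1" for x
    proof (cases "x \<in> carrier R")
      case True
      then show ?thesis
        using separable_poly_alg_mult[OF assms(1) True] by (simp only: alg_mult_eq_count_roots[OF p])
    next
      case False
      then have "x \<notin># roots p"
        using roots_mem_iff_is_root[OF p] by (simp add: is_root_def)
      then have "count (roots p) x = 0"
        by (rule iffD2[OF count_eq_zero_iff])
      then show ?thesis
        by linarith
    qed
    have S: "{x \<in> carrier R. eval p x = \<zero>} = set_mset (roots p)"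
      using roots_mem_iff_is_root[OF p] assms(3) by (auto simp: is_root_def)
    show ?thesis
      unfolding S
    proof (rule multiset_eqI)
      fix x
      show "count (roots p) x = count (mset_set (set_mset (roots p))) x"
      proof (cases "x \<in># roots p")
        case True
        then have "count (roots p) x = 1"
          using le1[of x] iffD2[OF count_greater_zero_iff True] by linarith
        then show ?thesis
          using True by (simp add: count_mset_set')
      next
        case False
        then show ?thesis
          using iffD2[OF count_eq_zero_iff False] by (simp add: count_mset_set')
      qed
    qed
  qed
  then show ?thesis
    using assms(2) unfolding splitted_def by simp
qed

section \<open>Extending embeddings inside a separable closure\<close>

text \<open>The homomorphism theorem for \<open>e : A \<rightarrow> B\<close>, phrased for the image of \<open>e\<close> as a subring of \<open>B\<close>.\<close>

lemma ring_hom_factor: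
  fixes A (structure) and B (structure) and C (structure)
  assumes "ring_hom_ring A B e" "ring_hom_ring A C \<phi>"
    and ker: "\<And>a. a \<in> carrier A \<Longrightarrow> e a = \<zero>\<^bsub>B\<^esub> \<Longrightarrow> \<phi> a = \<zero>\<^bsub>C\<^esub>"
  obtains g where "g \<in> ring_hom (B\<lparr>carrier := e ` carrier A\<rparr>) C"
    and "\<And>a. a \<in> carrier A \<Longrightarrow> g (e a) = \<phi> a"
proof -
  interpret e: ring_hom_ring A B e by fact
  interpret \<phi>: ring_hom_ring A C \<phi> by fact
  have eq: "\<phi> a = \<phi> b" if "a \<in> carrier A" "b \<in> carrier A" "e a = e b" for a b
  proof -
    have "e (a \<ominus>\<^bsub>A\<^esub> b) = \<zero>\<^bsub>B\<^esub>"
      using that by (simp add: a_minus_def e.S.r_neg)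
    then have "\<phi> (a \<ominus>\<^bsub>A\<^esub> b) = \<zero>\<^bsub>C\<^esub>"
      using that ker by simp
    then have "\<phi> a \<ominus>\<^bsub>C\<^esub> \<phi> b = \<zero>\<^bsub>C\<^esub>"
      using that by (simp add: a_minus_def)
    then show ?thesis
      using that \<phi>.S.r_right_minus_eq by simp
  qed
  define g where "g y = \<phi> (SOME a. a \<in> carrier A \<and> e a = y)" for y
  have g: "g (e a) = \<phi> a" if "a \<in> carrier A" for a
  proof -
    have "\<exists>b. b \<in> carrier A \<and> e b = e a"
      using that by blast
    then have "(SOME b. b \<in> carrier A \<and> e b = e a) \<in> carrier A \<and> e (SOME b. b \<in> carrier A \<and> e b = e a) = e a"
      by (rule someI_ex)
    then show ?thesis
      unfolding g_def using eq that by blast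
  qed
  have "g \<in> ring_hom (B\<lparr>carrier := e ` carrier A\<rparr>) C"
  proof (rule ring_hom_memI; clarsimp simp: g)
    fix a b assume ab: "a \<in> carrier A" "b \<in> carrier A"
    show "g (e a \<otimes>\<^bsub>B\<^esub> e b) = \<phi> a \<otimes>\<^bsub>C\<^esub> \<phi> b"
      using g[of "a \<otimes>\<^bsub>A\<^esub> b"] ab by simp
    show "g (e a \<oplus>\<^bsub>B\<^esub> e b) = \<phi> a \<oplus>\<^bsub>C\<^esub> \<phi> b"
      using g[of "a \<oplus>\<^bsub>A\<^esub> b"] ab by simp
  next
    show "g \<one>\<^bsub>B\<^esub> = \<one>\<^bsub>C\<^esub>"
      using g[of "\<one>\<^bsub>A\<^esub>"] by simp
  qed
  with g that show thesis by blast
qed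

text \<open>The evaluation \<open>F[X] \<rightarrow> R\<close> at \<open>w\<close>, where \<open>R\<close> is an \<open>F\<close>-algebra through \<open>f\<close> instead of the
  inclusion. Applying \<open>f\<close> to coefficients commutes with the operations only up to trimming leading
  zeros, hence the \<open>normalize\<close> in the second claim; evaluation does not see it.\<close>

lemma (in field) eval_map_hom:
  assumes F: "subfield F R" and f: "f \<in> ring_hom (R\<lparr>carrier := F\<rparr>) R" and w: "w \<in> carrier R"
  shows "ring_hom_ring (F[X]) R (\<lambda>p. eval (map f p) w)"
    and "\<And>p q. p \<in> carrier (F[X]) \<Longrightarrow> q \<in> carrier (F[X]) \<Longrightarrow>
           normalize (map f (p \<otimes>\<^bsub>F[X]\<^esub> q)) = poly_mult (map f p) (map f q)"
    and "\<And>p. p \<in> carrier (F[X]) \<Longrightarrow> map f p \<in> carrier (poly_ring R)"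
proof -
  note F' = subfieldE(1)[OF F]
  have RF: "field (R\<lparr>carrier := F\<rparr>)"
    using subfield_iff(2)[OF F] .
  interpret f: ring_hom_ring "R\<lparr>carrier := F\<rparr>" R f
    using ring_hom_ringI2[OF field.is_ring[OF RF] _ f] ring_axioms by blast
  have set: "set p \<subseteq> F" if "p \<in> carrier (F[X])" for p
    using that polynomial_incl unfolding sym[OF univ_poly_carrier] by blast
  have set': "set p \<subseteq> carrier (R\<lparr>carrier := F\<rparr>)" if "p \<in> carrier (F[X])" for p
    using set[OF that] by simp
  have setf: "set (map f p) \<subseteq> carrier R" if "set p \<subseteq> F" for p
    using that f.hom_closed by auto
  show mult: "normalize (map f (p \<otimes>\<^bsub>F[X]\<^esub> q)) = poly_mult (map f p) (map f q)"
    if "p \<in> carrier (F[X])" "q \<in> carrier (F[X])" for p q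
    using f.poly_mult_hom'[OF set'[OF that(1)] set'[OF that(2)]]
    unfolding univ_poly_mult poly_mult_consistent[OF F'] .
  have add: "normalize (map f (p \<oplus>\<^bsub>F[X]\<^esub> q)) = poly_add (map f p) (map f q)"
    if "p \<in> carrier (F[X])" "q \<in> carrier (F[X])" for p q
    using f.poly_add_hom'[OF set'[OF that(1)] set'[OF that(2)]]
    unfolding univ_poly_add poly_add_consistent[OF F'] .
  show "map f p \<in> carrier (poly_ring R)" if "p \<in> carrier (F[X])" for p
  proof -
    have "f a \<noteq> \<zero>" if "a \<in> F" "a \<noteq> \<zero>" for a
      using inj_onD[OF non_trivial_field_hom_is_inj[OF f RF field_axioms], of a \<zero>]
        that f.hom_zero subringE(2)[OF F'] by auto
    then show ?thesis
      using that f.hom_closed unfolding sym[OF univ_poly_carrier] polynomial_def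
      by (cases p) auto
  qed
  interpret P: ring "F[X]"
    using univ_poly_is_ring[OF F'] .
  have norm: "eval (map f p) w = eval (normalize (map f p)) w" if "p \<in> carrier (F[X])" for p
    using eval_normalize[OF setf[OF set[OF that]] w] by simp
  have "(\<lambda>p. eval (map f p) w) \<in> ring_hom (F[X]) R"
  proof (rule ring_hom_memI)
    fix p assume "p \<in> carrier (F[X])"
    then show "eval (map f p) w \<in> carrier R"
      using eval_in_carrier[OF setf[OF set] w] by simp
  next
    fix p q assume pq: "p \<in> carrier (F[X])" "q \<in> carrier (F[X])"
    show "eval (map f (p \<otimes>\<^bsub>F[X]\<^esub> q)) w = eval (map f p) w \<otimes> eval (map f q) w"
      unfolding norm[OF P.m_closed[OF pq]] mult[OF pq]
      by (rule eval_poly_mult[OF setf[OF set[OF pq(1)]] setf[OF set[OF pq(2)]] w])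
    show "eval (map f (p \<oplus>\<^bsub>F[X]\<^esub> q)) w = eval (map f p) w \<oplus> eval (map f q) w"
      unfolding norm[OF P.a_closed[OF pq]] add[OF pq]
      by (rule eval_poly_add[OF setf[OF set[OF pq(1)]] setf[OF set[OF pq(2)]] w])
  next
    show "eval (map f \<one>\<^bsub>F[X]\<^esub>) w = \<one>"
      using f.hom_one w by (simp add: univ_poly_one)
  qed
  then show "ring_hom_ring (F[X]) R (\<lambda>p. eval (map f p) w)"
    using ring_hom_ringI2[OF P.ring_axioms ring_axioms] by blast
qed

text \<open>Both \<open>F(z)\<close> and the sought image are quotients of \<open>F[X]\<close>: the kernel of evaluation at \<open>z\<close> is
  generated by the minimal polynomial of \<open>z\<close>, and the hypothesis on \<open>w\<close> says that this generator
  dies under the \<open>f\<close>-twisted evaluation at \<open>w\<close>.\<close>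

lemma (in field) extend_hom_simple_extension:
  assumes F: "subfield F R" and f: "f \<in> ring_hom (R\<lparr>carrier := F\<rparr>) R"
    and z: "z \<in> carrier R" "(algebraic over F) z"
    and w: "w \<in> carrier R" "eval (map f (Irr F z)) w = \<zero>"
  obtains g where "g \<in> ring_hom (R\<lparr>carrier := simple_extension F z\<rparr>) R"
    and "\<And>a. a \<in> F \<Longrightarrow> g a = f a" and "g z = w"
proof -
  note F' = subfieldE(1)[OF F]
  let ?\<phi> = "\<lambda>p. eval (map f p) w"
  interpret f: ring_hom_ring "F[X]" R ?\<phi>
    using eval_map_hom(1)[OF F f w(1)] .
  have f1: "f \<one> = \<one>" "\<And>a. a \<in> F \<Longrightarrow> f a \<in> carrier R"
    using ring_hom_memE[OF f] by auto
  have f0: "f \<zero> = \<zero>"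
    using ring_hom_zero[OF f subring_is_ring[OF F'] ring_axioms] by simp
  have ker: "?\<phi> p = \<zero>" if p: "p \<in> carrier (F[X])" "eval p z = \<zero>" for p
  proof -
    have "Irr F z pdivides p"
      using Irr_minimal[OF F z p] .
    then obtain r where r: "r \<in> carrier (F[X])" "p = Irr F z \<otimes>\<^bsub>F[X]\<^esub> r"
      unfolding pdivides_iff_shell[OF F IrrE(1)[OF F z] p(1)] by auto
    have "?\<phi> p = ?\<phi> (Irr F z) \<otimes> ?\<phi> r"
      unfolding r(2) using f.hom_mult[OF IrrE(1)[OF F z] r(1)] .
    then show ?thesis
      unfolding w(2) using f.hom_closed[OF r(1)] by simp
  qed
  obtain g where g: "g \<in> ring_hom (R\<lparr>carrier := (\<lambda>p. eval p z) ` carrier (F[X])\<rparr>) R"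
    and g': "\<And>p. p \<in> carrier (F[X]) \<Longrightarrow> g (eval p z) = ?\<phi> p"
    using ring_hom_factor[OF eval_ring_hom[OF F' z(1)] eval_map_hom(1)[OF F f w(1)] ker] by blast
  show thesis
  proof (rule that[of g])
    show "g \<in> ring_hom (R\<lparr>carrier := simple_extension F z\<rparr>) R"
      using g unfolding simple_extension_as_eval_img[OF subringE(1)[OF F'] z(1)] .
    show "g a = f a" if a: "a \<in> F" for a
    proof (cases "a = \<zero>")
      case True
      have "eval [] z = \<zero>" "?\<phi> [] = \<zero>" by simp_all
      then show ?thesis
        using g'[OF univ_poly_zero_closed] True f0 by simp
    next
      case False
      have "[a] \<in> carrier (F[X])"
        using a False unfolding sym[OF univ_poly_carrier] polynomial_def by simp
      then show ?thesis
        using g'[of "[a]"] a f1(2)[OF a] w z(1) subringE(1)[OF F'] by auto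
    qed
    have "[\<one>, \<zero>] \<in> carrier (F[X])"
      using subringE(2,3)[OF F'] unfolding sym[OF univ_poly_carrier] polynomial_def by simp
    then show "g z = w"
      using g'[of "[\<one>, \<zero>]"] f0 f1(1) z(1) w(1) by simp
  qed
qed

text \<open>The minimal polynomial of \<open>z\<close> over \<open>F\<close> divides \<open>p\<close>. As \<open>f\<close> fixes the coefficients of \<open>p\<close>, its
  conjugate by \<open>f\<close> still divides \<open>p\<close>, so it splits along with \<open>p\<close>.\<close>

lemma (in field) exists_root_of_conjugate:
  assumes F: "subfield F R" and f: "f \<in> ring_hom (R\<lparr>carrier := F\<rparr>) R"
    and z: "z \<in> carrier R"
    and p: "p \<in> carrier (F[X])" "p \<noteq> []" "splitted p" "eval p z = \<zero>" "map f p = p"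
  obtains w where "w \<in> carrier R" "eval (map f (Irr F z)) w = \<zero>"
proof -
  have alg: "(algebraic over F) z"
    using algebraicI[OF p(1,2,4)] .
  let ?q = "Irr F z"
  note q = IrrE[OF F z alg]
  have pR: "p \<in> carrier (poly_ring R)"
    using p(1) carrier_polynomial_shell[OF subfieldE(1)[OF F]] by blast
  obtain r where r: "r \<in> carrier (F[X])" "p = ?q \<otimes>\<^bsub>F[X]\<^esub> r"
    using Irr_minimal[OF F z alg p(1,4)]
    unfolding pdivides_iff_shell[OF F q(1) p(1)] by auto
  have "p = normalize (map f p)"
    using pR p(5) normalize_polynomial[of "carrier R" p] by (simp add: univ_poly_carrier)
  also have "\<dots> = poly_mult (map f ?q) (map f r)"
    using eval_map_hom(2)[OF F f zero_closed q(1) r(1)] r(2) by simp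
  finally have "map f ?q pdivides p"
    using eval_map_hom(3)[OF F f zero_closed r(1)]
    unfolding pdivides_def factor_def univ_poly_mult by blast
  then have "splitted (map f ?q)"
    using pdivides_imp_splitted[OF eval_map_hom(3)[OF F f zero_closed q(1)] pR p(2,3)] by simp
  then have "size (roots (map f ?q)) \<ge> 1"
    using pirreducible_degree[OF F q(1,2)] unfolding splitted_def by simp
  then obtain w where "w \<in># roots (map f ?q)"
    by (cases "roots (map f ?q) = {#}") auto
  then show thesis
    using that roots_mem_iff_is_root[OF eval_map_hom(3)[OF F f zero_closed q(1)]]
    by (auto simp: is_root_def)
qed

section \<open>The fixed field of the Galois group\<close>

text \<open>A \<open>K\<close>-embedding into \<open>L\<close> of an intermediate field is encoded by its graph, so that extension of
  embeddings is inclusion of sets and Zorn's lemma applies to a family of sets. Closure under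
  inverses makes the domain a field.\<close>

definition embedding_graph :: "('a, 'c) ring_scheme \<Rightarrow> 'a set \<Rightarrow> ('a \<times> 'a) set \<Rightarrow> bool" where
  "embedding_graph L K E \<longleftrightarrow> E \<subseteq> carrier L \<times> carrier L \<and> (\<forall>c\<in>K. (c, c) \<in> E) \<and> single_valued E \<and>
     (\<forall>x y x' y'. (x, y) \<in> E \<and> (x', y') \<in> E \<longrightarrow>
        (x \<oplus>\<^bsub>L\<^esub> x', y \<oplus>\<^bsub>L\<^esub> y') \<in> E \<and> (x \<otimes>\<^bsub>L\<^esub> x', y \<otimes>\<^bsub>L\<^esub> y') \<in> E) \<and>
     (\<forall>x y. (x, y) \<in> E \<longrightarrow> (\<ominus>\<^bsub>L\<^esub> x, \<ominus>\<^bsub>L\<^esub> y) \<in> E) \<and>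
     (\<forall>x y. (x, y) \<in> E \<and> x \<noteq> \<zero>\<^bsub>L\<^esub> \<longrightarrow> (inv\<^bsub>L\<^esub> x, inv\<^bsub>L\<^esub> y) \<in> E)"

lemma embedding_graph_Union:
  assumes C: "subset.chain {E. embedding_graph L K E} C" "C \<noteq> {}"
  shows "embedding_graph L K (\<Union>C)"
proof -
  have emb: "embedding_graph L K E" if "E \<in> C" for E
    using C that unfolding subset.chain_def by auto
  \<comment> \<open>Every condition involves at most two pairs, and these lie in one member of the chain.\<close>
  have common: "\<exists>E\<in>C. p \<in> E \<and> q \<in> E" if pq: "p \<in> \<Union>C" "q \<in> \<Union>C" for p q
  proof -
    from pq obtain D E where DE: "D \<in> C" "p \<in> D" "E \<in> C" "q \<in> E" by blast
    then have "D \<subseteq> E \<or> E \<subseteq> D"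
      using subset_chain_def C(1) by metis
    then show ?thesis using DE by blast
  qed
  have sv: "single_valued (\<Union>C)"
  proof (rule single_valuedI)
    fix x y z assume "(x, y) \<in> \<Union>C" "(x, z) \<in> \<Union>C"
    from common[OF this] obtain E where "E \<in> C" "(x, y) \<in> E" "(x, z) \<in> E" by blast
    then show "y = z" using emb[of E] unfolding embedding_graph_def single_valued_def by blast
  qed
  have op: "(x \<oplus>\<^bsub>L\<^esub> x', y \<oplus>\<^bsub>L\<^esub> y') \<in> \<Union>C \<and> (x \<otimes>\<^bsub>L\<^esub> x', y \<otimes>\<^bsub>L\<^esub> y') \<in> \<Union>C"
    if xy: "(x, y) \<in> \<Union>C" "(x', y') \<in> \<Union>C" for x y x' y'
  proof -
    from common[OF xy] obtain E where "E \<in> C" "(x, y) \<in> E" "(x', y') \<in> E" by blast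
    then show ?thesis using emb[of E] unfolding embedding_graph_def by blast
  qed
  have neg: "(\<ominus>\<^bsub>L\<^esub> x, \<ominus>\<^bsub>L\<^esub> y) \<in> \<Union>C" if "(x, y) \<in> \<Union>C" for x y
    using that emb unfolding embedding_graph_def by (metis UnionE UnionI)
  have invs: "(inv\<^bsub>L\<^esub> x, inv\<^bsub>L\<^esub> y) \<in> \<Union>C" if "(x, y) \<in> \<Union>C" "x \<noteq> \<zero>\<^bsub>L\<^esub>" for x y
    using that emb unfolding embedding_graph_def by (metis UnionE UnionI)
  have sub: "\<Union>C \<subseteq> carrier L \<times> carrier L"
    using emb unfolding embedding_graph_def by (intro Union_least) blast
  have K: "(c, c) \<in> \<Union>C" if "c \<in> K" for c
    using that emb C(2) unfolding embedding_graph_def by (metis UnionI ex_in_conv)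
  show ?thesis
    unfolding embedding_graph_def using sub K sv op neg invs by simp
qed

lemma (in field) embedding_graph_of_hom:
  assumes F: "subfield F R" "K \<subseteq> F" and f: "f \<in> ring_hom (R\<lparr>carrier := F\<rparr>) R"
    and fixK: "\<And>c. c \<in> K \<Longrightarrow> f c = c"
  shows "embedding_graph R K {(a, f a) | a. a \<in> F}"
proof -
  note F' = subringE[OF subfieldE(1)[OF F(1)]]
  interpret f: ring_hom_ring "R\<lparr>carrier := F\<rparr>" R f
    using ring_hom_ringI2[OF subring_is_ring[OF subfieldE(1)[OF F(1)]] ring_axioms f] .
  have neg: "f (\<ominus> a) = \<ominus> f a" if "a \<in> F" for a
  proof -
    have "f (\<ominus> a) \<oplus> f a = f (\<ominus> a \<oplus> a)"
      using that F'(5) f.hom_add[of "\<ominus> a" a] by simp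
    also have "\<dots> = \<zero>"
      using that F'(1) f.hom_zero l_neg[of a] by auto
    finally show ?thesis
      using that F'(5) f.hom_closed[of a] f.hom_closed[of "\<ominus> a"] minus_equality by simp
  qed
  have invf: "f (inv a) = inv (f a) \<and> inv a \<in> F" if a: "a \<in> F" "a \<noteq> \<zero>" for a
  proof -
    note i = subfield_m_inv[OF F(1), of a]
    have ia: "inv a \<in> F" "a \<otimes> inv a = \<one>" using i a by auto
    have "f a \<otimes> f (inv a) = \<one>"
      using f.hom_mult[of a "inv a"] f.hom_one ia a by simp
    then show ?thesis
      using f.hom_closed[of a] f.hom_closed[of "inv a"] ia a
        comm_inv_char[of "f a" "f (inv a)"] by simp
  qed
  show ?thesis
    unfolding embedding_graph_def
  proof (intro conjI ballI allI impI)
    show "{(a, f a) |a. a \<in> F} \<subseteq> carrier R \<times> carrier R"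
      using F'(1) f.hom_closed by auto
    show "(c, c) \<in> {(a, f a) |a. a \<in> F}" if "c \<in> K" for c
      using fixK[OF that] F(2) that by auto
    show "single_valued {(a, f a) |a. a \<in> F}"
      by (auto simp: single_valued_def)
  next
    fix x y x' y' assume "(x, y) \<in> {(a, f a) |a. a \<in> F} \<and> (x', y') \<in> {(a, f a) |a. a \<in> F}"
    then have x: "x \<in> F" "y = f x" "x' \<in> F" "y' = f x'" by auto
    show "(x \<oplus> x', y \<oplus> y') \<in> {(a, f a) |a. a \<in> F}"
      using x F'(7) f.hom_add[of x x'] by simp
    show "(x \<otimes> x', y \<otimes> y') \<in> {(a, f a) |a. a \<in> F}"
      using x F'(6) f.hom_mult[of x x'] by simp
  next
    fix x y assume "(x, y) \<in> {(a, f a) |a. a \<in> F}"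
    then show "(\<ominus> x, \<ominus> y) \<in> {(a, f a) |a. a \<in> F}"
      using neg F'(5) by auto
  next
    fix x y assume "(x, y) \<in> {(a, f a) |a. a \<in> F} \<and> x \<noteq> \<zero>"
    then show "(inv x, inv y) \<in> {(a, f a) |a. a \<in> F}"
      using invf by auto
  qed
qed

lemma (in field) hom_of_embedding_graph:
  assumes E: "embedding_graph R K E" and K: "subfield K R"
  obtains f where "subfield (Domain E) R" "K \<subseteq> Domain E"
    "f \<in> ring_hom (R\<lparr>carrier := Domain E\<rparr>) R" "\<And>c. c \<in> K \<Longrightarrow> f c = c"
    "E = {(a, f a) | a. a \<in> Domain E}"
proof -
  define f where "f a = (THE b. (a, b) \<in> E)" for a
  have E_D: "E \<subseteq> carrier R \<times> carrier R" "\<And>c. c \<in> K \<Longrightarrow> (c, c) \<in> E" "single_valued E"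
    "\<And>x y x' y'. (x, y) \<in> E \<Longrightarrow> (x', y') \<in> E \<Longrightarrow> (x \<oplus> x', y \<oplus> y') \<in> E"
    "\<And>x y x' y'. (x, y) \<in> E \<Longrightarrow> (x', y') \<in> E \<Longrightarrow> (x \<otimes> x', y \<otimes> y') \<in> E"
    "\<And>x y. (x, y) \<in> E \<Longrightarrow> (\<ominus> x, \<ominus> y) \<in> E"
    "\<And>x y. (x, y) \<in> E \<Longrightarrow> x \<noteq> \<zero> \<Longrightarrow> (inv x, inv y) \<in> E"
    using E unfolding embedding_graph_def by auto
  have f_eq: "f a = b" if "(a, b) \<in> E" for a b
    unfolding f_def using that E_D(3) by (auto simp: single_valued_def)
  have f_mem: "(a, f a) \<in> E" if "a \<in> Domain E" for a
    using that f_eq by auto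
  have one: "(\<one>, \<one>) \<in> E"
    using E_D(2) subringE(3)[OF subfieldE(1)[OF K]] by blast
  have "subring (Domain E) R"
  proof (rule subringI)
    show "Domain E \<subseteq> carrier R" using E_D(1) by auto
    show "\<one> \<in> Domain E" using one by blast
    show "\<ominus> h \<in> Domain E" if "h \<in> Domain E" for h
      using E_D(6)[OF f_mem[OF that]] by blast
    show "h \<otimes> h' \<in> Domain E" if "h \<in> Domain E" "h' \<in> Domain E" for h h'
      using E_D(5)[OF f_mem[OF that(1)] f_mem[OF that(2)]] by blast
    show "h \<oplus> h' \<in> Domain E" if "h \<in> Domain E" "h' \<in> Domain E" for h h'
      using E_D(4)[OF f_mem[OF that(1)] f_mem[OF that(2)]] by blast
  qed
  then have D: "subfield (Domain E) R"
  proof (rule subfieldI')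
    show "inv k \<in> Domain E" if "k \<in> Domain E - {\<zero>}" for k
      using E_D(7)[OF f_mem[of k]] that by blast
  qed
  have hom: "f \<in> ring_hom (R\<lparr>carrier := Domain E\<rparr>) R"
  proof (rule ring_hom_memI; simp)
    show "f x \<in> carrier R" if "x \<in> Domain E" for x
      using f_mem[OF that] E_D(1) by blast
    show "f (x \<otimes> y) = f x \<otimes> f y" if "x \<in> Domain E" "y \<in> Domain E" for x y
      using f_eq[OF E_D(5)[OF f_mem[OF that(1)] f_mem[OF that(2)]]] .
    show "f (x \<oplus> y) = f x \<oplus> f y" if "x \<in> Domain E" "y \<in> Domain E" for x y
      using f_eq[OF E_D(4)[OF f_mem[OF that(1)] f_mem[OF that(2)]]] .
    show "f \<one> = \<one>"
      using f_eq[OF one] .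
  qed
  show thesis
  proof (rule that[OF D _ hom])
    show "K \<subseteq> Domain E" using E_D(2) by blast
    show "f c = c" if "c \<in> K" for c using f_eq[OF E_D(2)[OF that]] .
    show "E = {(a, f a) |a. a \<in> Domain E}"
    proof (intro equalityI subrelI)
      fix a b assume "(a, b) \<in> E"
      then show "(a, b) \<in> {(a, f a) |a. a \<in> Domain E}"
        using f_eq[of a b] by auto
    next
      fix a b assume "(a, b) \<in> {(a, f a) |a. a \<in> Domain E}"
      then show "(a, b) \<in> E"
        using f_mem by blast
    qed
  qed
qed

context separable_closure
begin

lemma K_subfield: "subfield K L"
  by (rule subfield_axioms)

lemma Irr_nonempty:
  assumes "x \<in> carrier L"
  shows "Irr K x \<noteq> []"
proof
  assume "Irr K x = []"
  then show False
    using pirreducible_degree[OF K_subfield IrrE(1,2)[OF K_subfield assms algebraic_extension[OF assms]]]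
    by simp
qed

lemma Irr_separable:
  assumes "x \<in> carrier L"
  shows "separable_poly (carrier L) (Irr K x)"
proof -
  have "carrier (K[X]) \<subseteq> carrier (poly_ring L)"
    using carrier_polynomial_shell[OF subfieldE(1)[OF K_subfield]] by blast
  then show ?thesis
    using separable_extension[OF assms]
    unfolding separable_poly_def univ_poly_mult univ_poly_add univ_poly_one by blast
qed

lemma Irr_splitted:
  assumes "x \<in> carrier L"
  shows "splitted (Irr K x)"
  using separably_closed[OF _ Irr_separable[OF assms]] Irr_separable[OF assms]
  by (simp add: separable_poly_def)

text \<open>An endomorphism over \<open>K\<close> permutes the roots of the minimal polynomial of each element, because it
  is an injective self-map of a finite set; so every element is in the image.\<close>

lemma bij_K_endomorphism:
  assumes f: "f \<in> ring_hom L L" and fixK: "\<And>c. c \<in> K \<Longrightarrow> f c = c"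
  shows "bij_betw f (carrier L) (carrier L)"
proof -
  have inj: "inj_on f (carrier L)"
    using non_trivial_field_hom_is_inj[OF f field_axioms field_axioms] .
  interpret f: ring_hom_ring L L f
    using ring_hom_ringI2[OF ring_axioms ring_axioms f] .
  have "y \<in> f ` carrier L" if y: "y \<in> carrier L" for y
  proof -
    note p = IrrE[OF K_subfield y algebraic_extension[OF y]]
    let ?p = "Irr K y"
    have setp: "set ?p \<subseteq> K"
      using p(1) polynomial_incl unfolding sym[OF univ_poly_carrier] by blast
    have fp: "map f ?p = ?p"
      using setp fixK by (simp add: map_idI subset_iff)
    let ?S = "{x \<in> carrier L. eval ?p x = \<zero>}"
    have "f x \<in> ?S" if x: "x \<in> ?S" for x
    proof -
      have "set ?p \<subseteq> carrier L"
        using setp subfieldE(3)[OF K_subfield] by (rule subset_trans)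
      then have "f (eval ?p x) = eval ?p (f x)"
        using f.eval_hom'[of x ?p] x unfolding fp by blast
      then have "eval ?p (f x) = \<zero>"
        using x f.hom_zero by simp
      then show ?thesis
        using x f.hom_closed by simp
    qed
    then have "f ` ?S \<subseteq> ?S"
      by blast
    moreover have "finite ?S"
      using finite_number_of_roots[of ?p] Irr_nonempty[OF y] p(1)
        carrier_polynomial_shell[OF subfieldE(1)[OF K_subfield]] by (simp add: is_root_def)
    moreover have "inj_on f ?S"
      using inj by (rule inj_on_subset) blast
    ultimately have "f ` ?S = ?S"
      by (simp add: endo_inj_surj)
    then show ?thesis
      using y p(4) by blast
  qed
  then show ?thesis
    using inj f.hom_closed unfolding bij_betw_def by blast
qed

text \<open>The domain of a maximal extension is \<open>L\<close>: the minimal polynomial over \<open>K\<close> of an element \<open>z\<close> splits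
  in \<open>L\<close>, which provides a possible image of \<open>z\<close>, so the embedding extends to \<open>z\<close>.\<close>

lemma extend_to_automorphism:
  assumes F: "subfield F L" "K \<subseteq> F" and f: "f \<in> ring_hom (L\<lparr>carrier := F\<rparr>) L"
    and fixK: "\<And>c. c \<in> K \<Longrightarrow> f c = c"
  obtains \<sigma> where "\<sigma> \<in> Bij (carrier L)" "\<sigma> \<in> ring_hom L L" "\<And>c. c \<in> K \<Longrightarrow> \<sigma> c = c"
    "\<And>a. a \<in> F \<Longrightarrow> \<sigma> a = f a"
proof -
  let ?E0 = "{(a, f a) | a. a \<in> F}"
  let ?A = "{E. embedding_graph L K E \<and> ?E0 \<subseteq> E}"
  have E0: "?E0 \<in> ?A"
    using embedding_graph_of_hom[OF F f fixK] by blast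
  have "\<exists>M\<in>?A. \<forall>E\<in>?A. M \<subseteq> E \<longrightarrow> E = M"
  proof (rule subset_Zorn_nonempty)
    show "?A \<noteq> {}" using E0 by blast
    fix C assume C: "C \<noteq> {}" "subset.chain ?A C"
    then have "subset.chain {E. embedding_graph L K E} C"
      unfolding subset.chain_def by blast
    then have "embedding_graph L K (\<Union>C)"
      using embedding_graph_Union C(1) by blast
    moreover have "?E0 \<subseteq> \<Union>C"
      using C unfolding subset.chain_def by blast
    ultimately show "\<Union>C \<in> ?A" by blast
  qed
  then obtain M where M: "embedding_graph L K M" "?E0 \<subseteq> M"
    and max: "\<And>E. embedding_graph L K E \<Longrightarrow> M \<subseteq> E \<Longrightarrow> E = M"
    by (auto dest: subset_trans)
  obtain g where D: "subfield (Domain M) L" "K \<subseteq> Domain M"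
    and g: "g \<in> ring_hom (L\<lparr>carrier := Domain M\<rparr>) L" "\<And>c. c \<in> K \<Longrightarrow> g c = c"
    and Mg: "M = {(a, g a) | a. a \<in> Domain M}"
    using hom_of_embedding_graph[OF M(1) K_subfield] by blast
  let ?D = "Domain M"
  have "carrier L \<subseteq> ?D"
  proof
    fix z assume z: "z \<in> carrier L"
    note p = IrrE[OF K_subfield z algebraic_extension[OF z]]
    let ?p = "Irr K z"
    have setp: "set ?p \<subseteq> K"
      using p(1) polynomial_incl unfolding sym[OF univ_poly_carrier] by blast
    have pD: "?p \<in> carrier (?D[X])"
      using p(1) D(2) unfolding sym[OF univ_poly_carrier] polynomial_def by auto
    have gp: "map g ?p = ?p"
      using setp g(2) by (simp add: map_idI subset_iff)
    obtain w where w: "w \<in> carrier L" "eval (map g (Irr ?D z)) w = \<zero>"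
      using exists_root_of_conjugate[OF D(1) g(1) z pD Irr_nonempty[OF z] Irr_splitted[OF z] p(4) gp]
      by blast
    have alg: "(algebraic over ?D) z"
      using algebraic_mono[OF D(2) algebraic_extension[OF z]] .
    let ?D' = "simple_extension ?D z"
    obtain h where h: "h \<in> ring_hom (L\<lparr>carrier := ?D'\<rparr>) L" "\<And>a. a \<in> ?D \<Longrightarrow> h a = g a"
      using extend_hom_simple_extension[OF D(1) g(1) z alg w] by blast
    have D': "subfield ?D' L" "?D \<subseteq> ?D'" "z \<in> ?D'"
      using simple_extension_is_subfield[OF D(1) z] alg
        simple_extension_incl[OF subfieldE(3)[OF D(1)] z]
        simple_extension_mem[OF subfieldE(1)[OF D(1)] z] by auto
    have "K \<subseteq> ?D'"
      using D(2) D'(2) by (rule subset_trans)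
    moreover have "h c = c" if "c \<in> K" for c
      using h(2)[of c] g(2)[OF that] D(2) that by auto
    ultimately have "embedding_graph L K {(a, h a) | a. a \<in> ?D'}"
      using embedding_graph_of_hom[OF D'(1) _ h(1)] by blast
    moreover have "M \<subseteq> {(a, h a) | a. a \<in> ?D'}"
    proof (rule subrelI)
      fix a b assume ab: "(a, b) \<in> M"
      then have a: "a \<in> ?D" by blast
      have "b = g a"
        using ab by (subst (asm) Mg) blast
      then show "(a, b) \<in> {(a, h a) | a. a \<in> ?D'}"
        using h(2)[OF a] subsetD[OF D'(2) a] by auto
    qed
    ultimately have "{(a, h a) | a. a \<in> ?D'} = M"
      by (rule max)
    then show "z \<in> ?D"
      using D'(3) by blast
  qed
  then have DL: "?D = carrier L"
    using subfieldE(3)[OF D(1)] by blast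
  then have gL: "g \<in> ring_hom L L"
    using g(1) by simp
  let ?\<sigma> = "restrict g (carrier L)"
  have "?\<sigma> \<in> Bij (carrier L)"
    using bij_K_endomorphism[OF gL g(2)] by (simp add: Bij_def cong: bij_betw_cong)
  moreover have "?\<sigma> \<in> ring_hom L L"
    using ring_hom_memE[OF gL] by (intro ring_hom_memI) auto
  moreover have "?\<sigma> c = c" if "c \<in> K" for c
    using that g(2) subfieldE(3)[OF K_subfield] by auto
  moreover have "?\<sigma> a = f a" if "a \<in> F" for a
  proof -
    have "(a, f a) \<in> M" using M(2) that by blast
    then have "f a = g a" using Mg by blast
    then show ?thesis using that subfieldE(3)[OF F(1)] by auto
  qed
  ultimately show thesis by (rule that)
qed

text \<open>If \<open>x \<notin> K\<close>, its minimal polynomial has degree at least 2 and thus a root \<open>y \<noteq> x\<close>; the embedding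
  of \<open>K(x)\<close> with \<open>x \<mapsto> y\<close> extends to an automorphism of \<open>L\<close> that moves \<open>x\<close>.\<close>

lemma fixed_field_of_automorphisms:
  assumes x: "x \<in> carrier L"
    and fixed: "\<And>\<sigma>. \<sigma> \<in> Bij (carrier L) \<Longrightarrow> \<sigma> \<in> ring_hom L L \<Longrightarrow> (\<And>c. c \<in> K \<Longrightarrow> \<sigma> c = c) \<Longrightarrow> \<sigma> x = x"
  shows "x \<in> K"
proof (rule ccontr)
  assume "x \<notin> K"
  note K' = subfieldE(1)[OF K_subfield]
  note alg = algebraic_extension[OF x]
  note p = IrrE[OF K_subfield x alg]
  let ?p = "Irr K x"
  have p_deg: "degree ?p \<ge> 1"
    using pirreducible_degree[OF K_subfield p(1,2)] .
  have "degree ?p \<noteq> 1"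
  proof
    assume "degree ?p = 1"
    then obtain a b where ab: "?p = [a, b]" and "b \<in> K"
      using degree_oneE[OF p(1)] by blast
    then have "a = \<one>"
      using p(3) by simp
    then have b: "b \<in> carrier L" "x \<oplus> b = \<zero>"
      using p(4) x \<open>b \<in> K\<close> subfieldE(3)[OF K_subfield] unfolding ab by auto
    then have "x = \<ominus> b"
      using x minus_equality by simp
    then show False
      using \<open>x \<notin> K\<close> \<open>b \<in> K\<close> subringE(5)[OF K'] by simp
  qed
  then have "card {y \<in> carrier L. eval ?p y = \<zero>} \<ge> 2"
    using card_roots_separable_splitted[OF Irr_separable[OF x] Irr_splitted[OF x] Irr_nonempty[OF x]]
      p_deg by simp
  moreover have "card {y \<in> carrier L. eval ?p y = \<zero>} \<le> 1" if "{y \<in> carrier L. eval ?p y = \<zero>} \<subseteq> {x}"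
    using card_mono[OF _ that] by simp
  ultimately have "\<not> {y \<in> carrier L. eval ?p y = \<zero>} \<subseteq> {x}"
    by force
  then obtain y where y: "y \<in> carrier L" "eval ?p y = \<zero>" "y \<noteq> x"
    by blast
  have id: "(\<lambda>a. a) \<in> ring_hom (L\<lparr>carrier := K\<rparr>) L"
    using subfieldE(3)[OF K_subfield] by (intro ring_hom_memI) auto
  obtain g where g: "g \<in> ring_hom (L\<lparr>carrier := simple_extension K x\<rparr>) L"
    "\<And>a. a \<in> K \<Longrightarrow> g a = a" "g x = y"
    using extend_hom_simple_extension[OF K_subfield id x alg y(1)] y(2) by auto
  obtain \<sigma> where \<sigma>: "\<sigma> \<in> Bij (carrier L)" "\<sigma> \<in> ring_hom L L" "\<And>c. c \<in> K \<Longrightarrow> \<sigma> c = c"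
    "\<And>a. a \<in> simple_extension K x \<Longrightarrow> \<sigma> a = g a"
    using extend_to_automorphism[OF _ simple_extension_incl[OF subfieldE(3)[OF K_subfield] x] g(1,2)]
      simple_extension_is_subfield[OF K_subfield x] alg by blast
  have "\<sigma> x = y"
    using \<sigma>(4)[OF simple_extension_mem[OF K' x]] g(3) by simp
  then show False
    using fixed[OF \<sigma>(1-3)] y(3) by simp
qed

end

section \<open>Points of an algebraic group over a separable closure\<close>

lemma cring_ext_algebra:
  assumes "cring (L\<lparr>carrier := F\<rparr>)"
  shows "cring (ext_algebra L F)"
proof -
  have "(\<lambda>x. x) \<in> ring_iso (L\<lparr>carrier := F\<rparr>) (ext_algebra L F)"
    by (auto simp: ring_iso_def ring_hom_def ext_algebra_def bij_betw_def)
  from cring.ring_iso_imp_img_cring[OF assms this] show ?thesis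
    by (simp add: ext_algebra_def)
qed

lemma field_ext_algebra:
  assumes "field (L\<lparr>carrier := F\<rparr>)"
  shows "field (ext_algebra L F)"
proof -
  have "(\<lambda>x. x) \<in> ring_iso (L\<lparr>carrier := F\<rparr>) (ext_algebra L F)"
    by (auto simp: ring_iso_def ring_hom_def ext_algebra_def bij_betw_def)
  from field.ring_iso_imp_img_field[OF assms this] show ?thesis
    by (simp add: ext_algebra_def)
qed

lemma alg_hom_compose:
  assumes "f \<in> alg_hom k A B" "g \<in> alg_hom k B C" "algebra k A"
  shows "compose (carrier A) g f \<in> alg_hom k A C"
proof -
  interpret A: algebra k A by fact
  have f: "f \<in> ring_hom A B" and g: "g \<in> ring_hom B C"
    using assms by (auto simp: alg_hom_def)
  note f' = ring_hom_memE[OF f] and g' = ring_hom_memE[OF g]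
  have "compose (carrier A) g f \<in> ring_hom A C"
    by (rule ring_hom_memI) (simp_all add: compose_def f' g')
  then show ?thesis
    using assms f'(1) by (auto simp: alg_hom_def compose_def)
qed

lemma group_functorD:
  assumes "group_functor k G"
  shows "algebra k A \<Longrightarrow> group (pts G A)"
    and "algebra k A \<Longrightarrow> algebra k B \<Longrightarrow> f \<in> alg_hom k A B \<Longrightarrow>
      fmap G A B f \<in> hom (pts G A) (pts G B)"
    and "algebra k A \<Longrightarrow> x \<in> carrier (pts G A) \<Longrightarrow> fmap G A A (\<lambda>a\<in>carrier A. a) x = x"
    and "algebra k A \<Longrightarrow> algebra k B \<Longrightarrow> algebra k C \<Longrightarrow> f \<in> alg_hom k A B \<Longrightarrow>
      g \<in> alg_hom k B C \<Longrightarrow> x \<in> carrier (pts G A) \<Longrightarrow>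
      fmap G B C g (fmap G A B f x) = fmap G A C (compose (carrier A) g f) x"
proof -
  note * = assms[unfolded group_functor_def]
  show "algebra k A \<Longrightarrow> group (pts G A)"
    using * by blast
  show "algebra k A \<Longrightarrow> algebra k B \<Longrightarrow> f \<in> alg_hom k A B \<Longrightarrow>
      fmap G A B f \<in> hom (pts G A) (pts G B)"
    using * by blast
  show "algebra k A \<Longrightarrow> x \<in> carrier (pts G A) \<Longrightarrow> fmap G A A (\<lambda>a\<in>carrier A. a) x = x"
    using * by blast
  show "algebra k A \<Longrightarrow> algebra k B \<Longrightarrow> algebra k C \<Longrightarrow> f \<in> alg_hom k A B \<Longrightarrow>
      g \<in> alg_hom k B C \<Longrightarrow> x \<in> carrier (pts G A) \<Longrightarrow>
      fmap G B C g (fmap G A B f x) = fmap G A C (compose (carrier A) g f) x"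
    by (rule sym) (use * in blast)
qed

locale algebraic_group_over_sep_closure = separable_closure L K
  for L :: "'a ring" (structure) and K +
  fixes G :: "('a, 'a, 'g) alg_functor"
  assumes alg_group: "algebraic_group (L\<lparr>carrier := K\<rparr>) G"
begin

abbreviation "k \<equiv> L\<lparr>carrier := K\<rparr>"
abbreviation "KK \<equiv> ext_algebra L K"
abbreviation "LL \<equiv> ext_algebra L (carrier L)"
abbreviation "\<Gamma> \<equiv> galois_group L K"
abbreviation "GK \<equiv> rat_points L K G"
abbreviation "GL \<equiv> sep_points L G"
abbreviation "r \<equiv> rat_to_sep L K G"
abbreviation "act \<equiv> galois_act L G"

lemma K_sub: "K \<subseteq> carrier L"
  using subfieldE(3)[OF K_subfield] .

lemma group_functor_G: "group_functor k G"
  using alg_group unfolding algebraic_group_def by blast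

lemma field_k: "field k"
  using subfield_iff(2)[OF K_subfield] .

lemma algebra_ext_algebra:
  assumes F: "subfield F L" "K \<subseteq> F"
  shows "algebra k (ext_algebra L F)"
proof -
  note sub = subringE[OF subfieldE(1)[OF F(1)]]
  have FL: "x \<in> F \<Longrightarrow> x \<in> carrier L" and KF: "x \<in> K \<Longrightarrow> x \<in> F" for x
    using sub(1) F(2) by blast+
  have closed: "a \<otimes> x \<in> F" if "a \<in> K" "x \<in> F" for a x
    using that sub(6) KF by blast
  have "cring k" "cring (ext_algebra L F)"
    using cring_ext_algebra fieldE(1) field_k subfield_iff(2)[OF F(1)] by blast+
  then show ?thesis
    by (rule algebraI) (simp_all add: ext_algebra_def FL KF closed l_distr r_distr m_assoc)
qed

lemma algebra_KK: "algebra k KK" and algebra_LL: "algebra k LL"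
  by (rule algebra_ext_algebra[OF K_subfield subset_refl], rule algebra_ext_algebra[OF carrier_is_subfield K_sub])

lemma field_KK: "field KK" and field_LL: "field LL"
  by (rule field_ext_algebra[OF field_k], rule field_ext_algebra) (simp add: field_axioms)

lemma ext_algebra_simps [simp]:
  "carrier (ext_algebra L F) = F" "mult (ext_algebra L F) = mult L" "one (ext_algebra L F) = \<one>"
  "zero (ext_algebra L F) = \<zero>" "add (ext_algebra L F) = add L" "smult (ext_algebra L F) = mult L"
  by (simp_all add: ext_algebra_def)

lemma inclusion_alg_hom:
  assumes "subring F L" "K \<subseteq> F" "F \<subseteq> F'"
  shows "(\<lambda>x\<in>F. x) \<in> alg_hom k (ext_algebra L F) (ext_algebra L F')"
proof -
  have ops: "\<one> \<in> F" "\<And>x y. x \<in> F \<Longrightarrow> y \<in> F \<Longrightarrow> x \<otimes> y \<in> F" "\<And>x y. x \<in> F \<Longrightarrow> y \<in> F \<Longrightarrow> x \<oplus> y \<in> F"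
    using subringE(3,6,7)[OF assms(1)] by blast+
  have "(\<lambda>x\<in>F. x) \<in> ring_hom (ext_algebra L F) (ext_algebra L F')"
    by (rule ring_hom_memI) (simp_all add: ops subsetD[OF assms(3)])
  moreover have "\<forall>c\<in>K. \<forall>x\<in>F. (\<lambda>x\<in>F. x) (c \<otimes> x) = c \<otimes> (\<lambda>x\<in>F. x) x"
    using ops(2) assms(2) by (simp add: subset_iff)
  ultimately show ?thesis
    by (simp add: alg_hom_def)
qed

lemma incl_alg_hom: "(\<lambda>x\<in>K. x) \<in> alg_hom k KK LL"
  using inclusion_alg_hom[OF subfieldE(1)[OF K_subfield] subset_refl K_sub] .

lemma galoisD:
  assumes "\<sigma> \<in> carrier \<Gamma>"
  shows "\<sigma> \<in> ring_hom L L" "\<sigma> \<in> extensional (carrier L)" "\<And>c. c \<in> K \<Longrightarrow> \<sigma> c = c"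
    "\<sigma> \<in> Bij (carrier L)"
  using assms by (auto simp: galois_group_def Bij_def)

lemma galois_mult:
  assumes "\<sigma> \<in> carrier \<Gamma>" "\<tau> \<in> carrier \<Gamma>"
  shows "\<sigma> \<otimes>\<^bsub>\<Gamma>\<^esub> \<tau> = compose (carrier L) \<sigma> \<tau>" "\<sigma> \<otimes>\<^bsub>\<Gamma>\<^esub> \<tau> \<in> carrier \<Gamma>"
proof -
  show eq: "\<sigma> \<otimes>\<^bsub>\<Gamma>\<^esub> \<tau> = compose (carrier L) \<sigma> \<tau>"
    using assms by (simp add: galois_group_def BijGroup_def)
  note \<sigma> = galoisD[OF assms(1)] and \<tau> = galoisD[OF assms(2)]
  have "compose (carrier L) \<sigma> \<tau> \<in> ring_hom L L"
    using ring_hom_memE[OF \<sigma>(1)] ring_hom_memE[OF \<tau>(1)]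
    by (intro ring_hom_memI) (auto simp: compose_def)
  then show "\<sigma> \<otimes>\<^bsub>\<Gamma>\<^esub> \<tau> \<in> carrier \<Gamma>"
    unfolding eq using \<sigma> \<tau> compose_Bij[OF \<sigma>(4) \<tau>(4)] K_sub
    by (auto simp: galois_group_def compose_def)
qed

lemma galois_alg_hom:
  assumes "\<sigma> \<in> carrier \<Gamma>"
  shows "\<sigma> \<in> alg_hom k LL LL"
proof -
  note \<sigma> = galoisD[OF assms]
  have "\<sigma> \<in> ring_hom LL LL"
    using ring_hom_memE[OF \<sigma>(1)] by (intro ring_hom_memI) auto
  then show ?thesis
    using \<sigma> ring_hom_memE(2)[OF \<sigma>(1)] K_sub by (auto simp: alg_hom_def)
qed

lemma group_GK: "group GK" and group_GL: "group GL"
  using group_functorD(1)[OF group_functor_G] algebra_KK algebra_LL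
  by (auto simp: rat_points_def sep_points_def)

lemma r_hom: "r \<in> hom GK GL"
  using group_functorD(2)[OF group_functor_G algebra_KK algebra_LL incl_alg_hom]
  by (simp add: rat_points_def sep_points_def rat_to_sep_def)

lemma act_hom:
  assumes "\<sigma> \<in> carrier \<Gamma>"
  shows "act \<sigma> \<in> hom GL GL"
  using group_functorD(2)[OF group_functor_G algebra_LL algebra_LL galois_alg_hom[OF assms]]
  by (simp add: sep_points_def galois_act_def)

lemma act_mult:
  assumes "\<sigma> \<in> carrier \<Gamma>" "\<tau> \<in> carrier \<Gamma>" "x \<in> carrier GL"
  shows "act (\<sigma> \<otimes>\<^bsub>\<Gamma>\<^esub> \<tau>) x = act \<sigma> (act \<tau> x)"
  using group_functorD(4)[OF group_functor_G algebra_LL algebra_LL algebra_LL galois_alg_hom[OF assms(2)]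
      galois_alg_hom[OF assms(1)], of x] assms(3)
  by (simp add: galois_mult(1)[OF assms(1,2)] sep_points_def galois_act_def)

lemma act_r:
  assumes "\<sigma> \<in> carrier \<Gamma>" "x \<in> carrier GK"
  shows "act \<sigma> (r x) = r x"
proof -
  have "compose K \<sigma> (\<lambda>x\<in>K. x) = (\<lambda>x\<in>K. x)"
    using galoisD(3)[OF assms(1)] by (auto simp: compose_def restrict_def)
  then show ?thesis
    using group_functorD(4)[OF group_functor_G algebra_KK algebra_LL algebra_LL incl_alg_hom
        galois_alg_hom[OF assms(1)], of x] assms(2)
    by (simp add: rat_points_def rat_to_sep_def galois_act_def)
qed

text \<open>A field-valued point lies in one of the affine open subfunctors \<open>U\<close>, and the points of \<open>U\<close> with
  values in \<open>C\<close> are coordinatized by the homomorphisms \<open>A \<rightarrow> C\<close>. The next three results are read off from this description.\<close>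

lemma affine_chart:
  assumes B: "algebra k B" "field B" and x: "x \<in> carrier (pts G B)"
  obtains U A \<xi> where "open_subfunctor k G U" "x \<in> U B"
    and "fin_gen_algebra k A" "algebra k A" "\<xi> \<in> carrier (pts G A)"
    and "\<forall>C. algebra k C \<longrightarrow> bij_betw (\<lambda>f. fmap G A C f \<xi>) (alg_hom k A C) (U C)"
proof -
  obtain \<U> where \<U>: "\<forall>U\<in>\<U>. open_subfunctor k G U \<and> affine_fin_type k G U"
    and cov: "\<forall>F. algebra k F \<and> field F \<longrightarrow> carrier (pts G F) = (\<Union>U\<in>\<U>. U F)"
    using alg_group unfolding algebraic_group_def by (elim conjE exE) simp
  obtain U where U: "U \<in> \<U>" "x \<in> U B"
    using cov B x by blast
  then obtain A \<xi> where A: "fin_gen_algebra k A" "\<xi> \<in> U A"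
    and bij: "\<forall>C. algebra k C \<longrightarrow> bij_betw (\<lambda>f. fmap G A C f \<xi>) (alg_hom k A C) (U C)"
    using \<U> unfolding affine_fin_type_def by blast
  have alg: "algebra k A"
    using A(1) unfolding fin_gen_algebra_def by blast
  have "U A \<subseteq> carrier (pts G A)"
    using \<U> U(1) alg unfolding open_subfunctor_def subfunctor_def by blast
  then show thesis
    using that[OF _ U(2) A(1) alg _ bij] \<U> U(1) A(2) by blast
qed

text \<open>In a chart, \<open>x\<close> is a homomorphism \<open>f : A \<rightarrow> L\<close> and \<open>\<sigma> x\<close> is \<open>\<sigma> \<circ> f\<close>. Invariance means that the values
  of \<open>f\<close> are fixed by the Galois group, so \<open>f\<close> factors through \<open>K\<close>.\<close>

lemma fixed_points_rational:
  assumes x: "x \<in> carrier GL" and fixed: "\<And>\<sigma>. \<sigma> \<in> carrier \<Gamma> \<Longrightarrow> act \<sigma> x = x"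
  shows "x \<in> r ` carrier GK"
proof -
  obtain U A \<xi> where U: "x \<in> U LL" and A: "algebra k A" and \<xi>: "\<xi> \<in> carrier (pts G A)"
    and bij: "\<forall>C. algebra k C \<longrightarrow> bij_betw (\<lambda>f. fmap G A C f \<xi>) (alg_hom k A C) (U C)"
    by (rule affine_chart[OF algebra_LL field_LL x[unfolded sep_points_def]]) blast
  obtain f where f: "f \<in> alg_hom k A LL" "fmap G A LL f \<xi> = x"
  proof -
    have "x \<in> (\<lambda>f. fmap G A LL f \<xi>) ` alg_hom k A LL"
      using bij_betw_imp_surj_on[OF bij[rule_format, OF algebra_LL]] U by simp
    then show thesis by (elim imageE) (rule that, simp_all)
  qed
  have f_in: "f a \<in> carrier L" if "a \<in> carrier A" for a
    using f(1) ring_hom_memE(1)[of f A LL a] that by (simp add: alg_hom_def)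
  have fK: "f a \<in> K" if a: "a \<in> carrier A" for a
  proof (rule fixed_field_of_automorphisms[OF f_in[OF a]])
    fix \<sigma> assume "\<sigma> \<in> Bij (carrier L)" "\<sigma> \<in> ring_hom L L" "\<And>c. c \<in> K \<Longrightarrow> \<sigma> c = c"
    then have \<sigma>: "\<sigma> \<in> carrier \<Gamma>"
      by (simp add: galois_group_def)
    have "fmap G A LL (compose (carrier A) \<sigma> f) \<xi> = fmap G LL LL \<sigma> (fmap G A LL f \<xi>)"
      using group_functorD(4)[OF group_functor_G A algebra_LL algebra_LL f(1) galois_alg_hom[OF \<sigma>] \<xi>] by simp
    also have "\<dots> = fmap G A LL f \<xi>"
      using fixed[OF \<sigma>] f(2) by (simp add: galois_act_def)
    finally have "compose (carrier A) \<sigma> f = f"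
      using bij_betw_imp_inj_on[OF bij[rule_format, OF algebra_LL]] f(1)
        alg_hom_compose[OF f(1) galois_alg_hom[OF \<sigma>] A] by (simp add: inj_on_def)
    then have "compose (carrier A) \<sigma> f a = f a" by simp
    then show "\<sigma> (f a) = f a" using a by (simp add: compose_def)
  qed
  have f': "f \<in> alg_hom k A KK"
  proof -
    have "f \<in> ring_hom A LL" using f(1) by (simp add: alg_hom_def)
    then have "f \<in> ring_hom A KK"
      using fK by (auto simp: ring_hom_def)
    then show ?thesis
      using f(1) by (auto simp: alg_hom_def)
  qed
  let ?y = "fmap G A KK f \<xi>"
  have y: "?y \<in> carrier GK"
    using group_functorD(2)[OF group_functor_G A algebra_KK f'] \<xi> by (auto simp: hom_def rat_points_def)
  have "compose (carrier A) (\<lambda>x\<in>K. x) f = f"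
    using f' fK by (auto simp: alg_hom_def compose_def extensional_def)
  then have "r ?y = x"
    using group_functorD(4)[OF group_functor_G A algebra_KK algebra_LL f' incl_alg_hom \<xi>] f(2)
    by (simp add: rat_to_sep_def)
  with y show ?thesis by blast
qed

text \<open>Two points of one chart are told apart by their coordinates, and these do not change from \<open>K\<close> to
  \<open>L\<close>. To bring \<open>y\<close> into a chart of \<open>x\<close>, use that the chart is open: the inverse image of the chart
  along \<open>y\<close> is the open subscheme of \<open>Spec K\<close> given by an ideal \<open>I\<close> of \<open>K\<close>. It contains the
  image of \<open>Spec L\<close>, so \<open>I \<noteq> 0\<close> and therefore \<open>I = K\<close>.\<close>

lemma r_inj: "inj_on r (carrier GK)"
proof (rule inj_onI)
  fix x y assume xy: "x \<in> carrier GK" "y \<in> carrier GK" and eq: "r x = r y"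
  obtain U A \<xi> where op: "open_subfunctor k G U" and U: "x \<in> U KK"
    and A: "algebra k A" and \<xi>: "\<xi> \<in> carrier (pts G A)"
    and bij: "\<forall>C. algebra k C \<longrightarrow> bij_betw (\<lambda>f. fmap G A C f \<xi>) (alg_hom k A C) (U C)"
    by (rule affine_chart[OF algebra_KK field_KK xy(1)[unfolded rat_points_def]]) blast
  have "r x \<in> U LL"
    using op U algebra_KK algebra_LL incl_alg_hom
    unfolding open_subfunctor_def subfunctor_def rat_to_sep_def by blast
  then have ry: "fmap G KK LL (\<lambda>x\<in>K. x) y \<in> U LL"
    using eq by (simp add: rat_to_sep_def)
  obtain I where I: "ideal I KK"
    and test: "\<And>B f. algebra k B \<Longrightarrow> f \<in> alg_hom k KK B \<Longrightarrow>
      (fmap G KK B f y \<in> U B \<longleftrightarrow> Idl\<^bsub>B\<^esub> (f ` I) = carrier B)"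
    using op algebra_KK xy(2) unfolding open_subfunctor_def rat_points_def by blast
  interpret KK: field KK by (rule field_KK)
  interpret LL: field LL by (rule field_LL)
  have "I = K"
  proof (rule ccontr)
    assume "I \<noteq> K"
    then have "I = {\<zero>}"
      using KK.all_ideals I by auto
    then have "(\<lambda>x\<in>K. x) ` I = {\<zero>\<^bsub>LL\<^esub>}"
      using subringE(2)[OF subfieldE(1)[OF K_subfield]] by auto
    then have "Idl\<^bsub>LL\<^esub> ((\<lambda>x\<in>K. x) ` I) \<subseteq> {\<zero>}"
      using LL.genideal_minimal[OF LL.zeroideal, of "{\<zero>\<^bsub>LL\<^esub>}"] by simp
    then have "carrier L \<subseteq> {\<zero>}"
      using test[OF algebra_LL incl_alg_hom] ry by simp
    then show False
      using one_closed one_not_zero by blast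
  qed
  have id: "(\<lambda>x\<in>K. x) \<in> alg_hom k KK KK"
    using inclusion_alg_hom[OF subfieldE(1)[OF K_subfield] subset_refl subset_refl] .
  have "(\<lambda>x\<in>K. x) ` I = carrier KK"
    using \<open>I = K\<close> by auto
  then have "Idl\<^bsub>KK\<^esub> ((\<lambda>x\<in>K. x) ` I) = carrier KK"
    using KK.genideal_self[of "carrier KK"] KK.genideal_minimal[OF KK.oneideal, of "carrier KK"] by auto
  then have "fmap G KK KK (\<lambda>x\<in>K. x) y \<in> U KK"
    using test[OF algebra_KK id] by simp
  then have yU: "y \<in> U KK"
    using group_functorD(3)[OF group_functor_G algebra_KK, of y] xy(2) by (simp add: rat_points_def)
  have onto: "w \<in> (\<lambda>f. fmap G A KK f \<xi>) ` alg_hom k A KK" if "w \<in> U KK" for w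
    using bij_betw_imp_surj_on[OF bij[rule_format, OF algebra_KK]] that by simp
  obtain f g where f: "f \<in> alg_hom k A KK" "fmap G A KK f \<xi> = x"
    and g: "g \<in> alg_hom k A KK" "fmap G A KK g \<xi> = y"
    using onto[OF U] onto[OF yU] by (elim imageE) (rule that, simp_all)
  have "fmap G A LL (compose (carrier A) (\<lambda>x\<in>K. x) f) \<xi> = fmap G A LL (compose (carrier A) (\<lambda>x\<in>K. x) g) \<xi>"
    using group_functorD(4)[OF group_functor_G A algebra_KK algebra_LL _ incl_alg_hom \<xi>] f g eq
    by (metis rat_to_sep_def)
  then have "compose (carrier A) (\<lambda>x\<in>K. x) f = compose (carrier A) (\<lambda>x\<in>K. x) g"
    using inj_onD[OF bij_betw_imp_inj_on[OF bij[rule_format, OF algebra_LL]]]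
      alg_hom_compose[OF f(1) incl_alg_hom A] alg_hom_compose[OF g(1) incl_alg_hom A] by blast
  moreover have "compose (carrier A) (\<lambda>x\<in>K. x) h = h" if "h \<in> alg_hom k A KK" for h
  proof
    fix a
    have "h a \<in> K" if "a \<in> carrier A"
      using \<open>h \<in> alg_hom k A KK\<close> ring_hom_memE(1)[of h A KK a] that by (simp add: alg_hom_def)
    then show "compose (carrier A) (\<lambda>x\<in>K. x) h a = h a"
      using \<open>h \<in> alg_hom k A KK\<close> by (auto simp: alg_hom_def compose_def extensional_def)
  qed
  ultimately show "x = y"
    using f g by metis
qed

text \<open>In a chart, \<open>x\<close> is a homomorphism \<open>f\<close> on a finitely generated algebra, and \<open>\<sigma> \<circ> f\<close> depends only on
  the values of \<open>\<sigma>\<close> at the images of the generators. These generate a finite extension of \<open>K\<close>.\<close>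

lemma orbit_map_locally_constant:
  assumes x: "x \<in> carrier GL"
  obtains F where "subfield F L" "K \<subseteq> F" "finite_dimension K F"
    "\<And>\<sigma> \<tau>. \<sigma> \<in> carrier \<Gamma> \<Longrightarrow> \<tau> \<in> carrier \<Gamma> \<Longrightarrow> (\<And>a. a \<in> F \<Longrightarrow> \<sigma> a = \<tau> a) \<Longrightarrow> act \<sigma> x = act \<tau> x"
proof -
  obtain U A \<xi> where U: "x \<in> U LL" and fg: "fin_gen_algebra k A"
    and A: "algebra k A" and \<xi>: "\<xi> \<in> carrier (pts G A)"
    and bij: "\<forall>C. algebra k C \<longrightarrow> bij_betw (\<lambda>f. fmap G A C f \<xi>) (alg_hom k A C) (U C)"
    by (rule affine_chart[OF algebra_LL field_LL x[unfolded sep_points_def]]) blast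
  obtain f where f: "f \<in> alg_hom k A LL" "fmap G A LL f \<xi> = x"
  proof -
    have "x \<in> (\<lambda>f. fmap G A LL f \<xi>) ` alg_hom k A LL"
      using bij_betw_imp_surj_on[OF bij[rule_format, OF algebra_LL]] U by simp
    then show thesis by (elim imageE) (rule that, simp_all)
  qed
  obtain S where S: "finite S" "S \<subseteq> carrier A"
    and gen: "\<And>T. subring T A \<Longrightarrow> S \<subseteq> T \<Longrightarrow> (\<forall>c\<in>carrier k. \<forall>x\<in>T. c \<odot>\<^bsub>A\<^esub> x \<in> T) \<Longrightarrow> T = carrier A"
  proof -
    from fg obtain S where "finite S" "S \<subseteq> carrier A" "\<forall>T. subring T A \<and> S \<subseteq> T \<and>
        (\<forall>c\<in>carrier k. \<forall>x\<in>T. c \<odot>\<^bsub>A\<^esub> x \<in> T) \<longrightarrow> T = carrier A"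
      unfolding fin_gen_algebra_def by (elim conjE exE)
    then show thesis
      by (intro that[of S]) simp_all
  qed
  have f_hom: "f \<in> ring_hom A LL" using f(1) by (simp add: alg_hom_def)
  note fE = ring_hom_memE[OF f_hom, simplified]
  interpret AR: cring A by (rule algebra.M_cring[OF A])
  interpret f: ring_hom_ring A LL f
    by (rule ring_hom_ringI2[OF AR.ring_axioms field.is_ring[OF field_LL] f_hom])
  obtain xs where xs: "set xs = f ` S"
    using finite_list[OF finite_imageI[OF S(1)], of f] by blast
  have xs_L: "set xs \<subseteq> carrier L" using xs S(2) fE(1) by auto
  have xs_alg: "(algebraic over K) y" if "y \<in> set xs" for y
    using that xs_L algebraic_extension by blast
  let ?F = "finite_extension K xs"
  show thesis
  proof (rule that[of ?F])
    show "subfield ?F L" using finite_extension_is_subfield[OF K_subfield xs_L xs_alg] .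
    show "K \<subseteq> ?F" using finite_extension_incl[OF K_sub xs_L] .
    show "finite_dimension K ?F" using finite_extension_finite_dimension(1)[OF K_subfield xs_L xs_alg] .
    fix \<sigma> \<tau> assume \<sigma>: "\<sigma> \<in> carrier \<Gamma>" and \<tau>: "\<tau> \<in> carrier \<Gamma>" and agree: "\<And>a. a \<in> ?F \<Longrightarrow> \<sigma> a = \<tau> a"
    note s = ring_hom_memE[OF galoisD(1)[OF \<sigma>]] and t = ring_hom_memE[OF galoisD(1)[OF \<tau>]]
    interpret \<sigma>: ring_hom_ring L L \<sigma>
      using ring_hom_ringI2[OF ring_axioms ring_axioms galoisD(1)[OF \<sigma>]] .
    interpret \<tau>: ring_hom_ring L L \<tau>
      using ring_hom_ringI2[OF ring_axioms ring_axioms galoisD(1)[OF \<tau>]] .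
    let ?T = "{a \<in> carrier A. \<sigma> (f a) = \<tau> (f a)}"
    have "subring ?T A"
    proof (rule AR.subringI)
      show "?T \<subseteq> carrier A" by blast
      show "\<one>\<^bsub>A\<^esub> \<in> ?T" using fE(4) s(4) t(4) by simp
      show "\<ominus>\<^bsub>A\<^esub> h \<in> ?T" if "h \<in> ?T" for h
      proof -
        have h: "h \<in> carrier A" "\<sigma> (f h) = \<tau> (f h)"
          using that by simp_all
        have "f (\<ominus>\<^bsub>A\<^esub> h) \<oplus> f h = f (\<ominus>\<^bsub>A\<^esub> h \<oplus>\<^bsub>A\<^esub> h)"
          by (rule fE(3)[symmetric]) (simp_all add: h)
        also have "\<dots> = \<zero>"
          using f.hom_zero by (simp add: AR.l_neg[OF h(1)])
        finally have "\<ominus> f h = f (\<ominus>\<^bsub>A\<^esub> h)"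
          by (rule minus_equality[OF _ fE(1)[OF h(1)] fE(1)[OF AR.a_inv_closed[OF h(1)]]])
        then have "\<sigma> (f (\<ominus>\<^bsub>A\<^esub> h)) = \<tau> (f (\<ominus>\<^bsub>A\<^esub> h))"
          using \<sigma>.hom_a_inv[OF fE(1)[OF h(1)]] \<tau>.hom_a_inv[OF fE(1)[OF h(1)]] h(2)
          by (simp del: f.hom_a_inv)
        then show ?thesis
          using h(1) by simp
      qed
      show "h1 \<otimes>\<^bsub>A\<^esub> h2 \<in> ?T" if "h1 \<in> ?T" "h2 \<in> ?T" for h1 h2
        using that fE(1,2) s(2) t(2) by simp
      show "h1 \<oplus>\<^bsub>A\<^esub> h2 \<in> ?T" if "h1 \<in> ?T" "h2 \<in> ?T" for h1 h2
        using that fE(1,3) s(3) t(3) by simp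
    qed
    moreover have "S \<subseteq> ?T"
      using S(2) agree finite_extension_mem[OF subfieldE(1)[OF K_subfield] xs_L] xs by blast
    moreover have "\<forall>c\<in>carrier k. \<forall>x\<in>?T. c \<odot>\<^bsub>A\<^esub> x \<in> ?T"
      using f(1) fE(1) s(2) t(2) galoisD(3)[OF \<sigma>] galoisD(3)[OF \<tau>] K_sub module.smult_closed[OF algebra.axioms(1)[OF A]]
      by (auto simp: alg_hom_def subset_iff)
    ultimately have T: "?T = carrier A" by (rule gen)
    have "compose (carrier A) \<sigma> f = compose (carrier A) \<tau> f"
      unfolding compose_def using T by (intro restrict_ext) blast
    then show "act \<sigma> x = act \<tau> x"
      using group_functorD(4)[OF group_functor_G A algebra_LL algebra_LL f(1) galois_alg_hom[OF \<sigma>] \<xi>]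
        group_functorD(4)[OF group_functor_G A algebra_LL algebra_LL f(1) galois_alg_hom[OF \<tau>] \<xi>] f(2)
      by (simp add: galois_act_def)
  qed
qed

end

section \<open>Groups with operators\<close>

lemma (in group) cancel_left [simp]:
  assumes "x \<in> carrier G" "y \<in> carrier G"
  shows "x \<otimes> (inv x \<otimes> y) = y" "inv x \<otimes> (x \<otimes> y) = y"
  using assms by (simp_all add: m_assoc[symmetric])

lemma (in group) subgroup_centralizer:
  assumes "S \<subseteq> carrier G"
  shows "subgroup (centralizer G S) G"
proof (rule subgroupI)
  show "centralizer G S \<subseteq> carrier G" by (auto simp: centralizer_def)
  show "centralizer G S \<noteq> {}"
    using assms by (auto simp: centralizer_def intro!: exI[of _ \<one>])
  show "inv z \<in> centralizer G S" if "z \<in> centralizer G S" for z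
    unfolding centralizer_def
  proof (intro CollectI conjI ballI)
    show "inv z \<in> carrier G" using that by (auto simp: centralizer_def)
    fix s assume s: "s \<in> S"
    then have "z \<in> carrier G" "s \<in> carrier G" "z \<otimes> s = s \<otimes> z"
      using that assms by (auto simp: centralizer_def)
    then have "inv z \<otimes> (z \<otimes> s) \<otimes> inv z = inv z \<otimes> (s \<otimes> z) \<otimes> inv z" by simp
    then show "inv z \<otimes> s = s \<otimes> inv z"
      using \<open>z \<in> carrier G\<close> \<open>s \<in> carrier G\<close> by (simp add: m_assoc)
  qed
  show "z \<otimes> w \<in> centralizer G S" if "z \<in> centralizer G S" "w \<in> centralizer G S" for z w
    using that assms by (auto simp: centralizer_def subset_iff m_assoc) (metis m_assoc)
qed

lemma equiv_cohomologous:
  fixes A :: "('g, 'd) monoid_scheme" (structure)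
  assumes A: "group A" and hom: "\<And>\<sigma>. \<sigma> \<in> carrier \<Gamma> \<Longrightarrow> act \<sigma> \<in> hom A A"
  shows "equiv (cocycles \<Gamma> T A act) (cohomologous \<Gamma> T A act)"
proof -
  interpret group A by fact
  have gh: "group_hom A A (act \<sigma>)" if "\<sigma> \<in> carrier \<Gamma>" for \<sigma>
    by unfold_locales (rule hom[OF that])
  note act = group_hom.hom_closed[OF gh] group_hom.hom_mult[OF gh] group_hom.hom_one[OF gh]
    group_hom.hom_inv[OF gh]
  have val: "a \<sigma> \<in> carrier A" if "a \<in> cocycles \<Gamma> T A act" "\<sigma> \<in> carrier \<Gamma>" for a \<sigma>
    using that by (auto simp: cocycles_def)
  have "(a, a) \<in> cohomologous \<Gamma> T A act" if "a \<in> cocycles \<Gamma> T A act" for a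
  proof -
    have "\<forall>\<sigma>\<in>carrier \<Gamma>. a \<sigma> = inv \<one> \<otimes> a \<sigma> \<otimes> act \<sigma> \<one>"
      using act(3) val[OF that] by simp
    then show ?thesis
      using that unfolding cohomologous_def by blast
  qed
  moreover have "(a', a) \<in> cohomologous \<Gamma> T A act" if "(a, a') \<in> cohomologous \<Gamma> T A act" for a a'
  proof -
    from that obtain b where b: "b \<in> carrier A" and a: "a \<in> cocycles \<Gamma> T A act" "a' \<in> cocycles \<Gamma> T A act"
      and eq: "\<And>\<sigma>. \<sigma> \<in> carrier \<Gamma> \<Longrightarrow> a' \<sigma> = inv b \<otimes> a \<sigma> \<otimes> act \<sigma> b"
      unfolding cohomologous_def by blast
    have "a \<sigma> = inv (inv b) \<otimes> a' \<sigma> \<otimes> act \<sigma> (inv b)" if "\<sigma> \<in> carrier \<Gamma>" for \<sigma>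
      using eq[OF that] val[OF a(1) that] b act(1,4)[OF that b] by (simp add: m_assoc)
    then show ?thesis
      using a b unfolding cohomologous_def by blast
  qed
  moreover have "(a, a'') \<in> cohomologous \<Gamma> T A act"
    if "(a, a') \<in> cohomologous \<Gamma> T A act" "(a', a'') \<in> cohomologous \<Gamma> T A act" for a a' a''
  proof -
    from that obtain b c where b: "b \<in> carrier A" and c: "c \<in> carrier A"
      and a: "a \<in> cocycles \<Gamma> T A act" "a'' \<in> cocycles \<Gamma> T A act"
      and eq: "\<And>\<sigma>. \<sigma> \<in> carrier \<Gamma> \<Longrightarrow> a' \<sigma> = inv b \<otimes> a \<sigma> \<otimes> act \<sigma> b"
        "\<And>\<sigma>. \<sigma> \<in> carrier \<Gamma> \<Longrightarrow> a'' \<sigma> = inv c \<otimes> a' \<sigma> \<otimes> act \<sigma> c"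
      unfolding cohomologous_def by blast
    have "a'' \<sigma> = inv (b \<otimes> c) \<otimes> a \<sigma> \<otimes> act \<sigma> (b \<otimes> c)" if "\<sigma> \<in> carrier \<Gamma>" for \<sigma>
      using eq(1,2)[OF that] val[OF a(1) that] b c act(2)[OF that b c] act(1)[OF that b] act(1)[OF that c]
      by (simp add: m_assoc inv_mult_group)
    then show ?thesis
      using a b c unfolding cohomologous_def by blast
  qed
  moreover have "cohomologous \<Gamma> T A act \<subseteq> cocycles \<Gamma> T A act \<times> cocycles \<Gamma> T A act"
    unfolding cohomologous_def by blast
  ultimately show ?thesis
    by (intro equivI refl_onI symI transI) blast+
qed

text \<open>Two surjections \<open>p\<close> and \<open>q\<close> from one set with the same fibres: their targets are identified by a
  unique bijection compatible with them.\<close>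

lemma unique_bijection_through:
  assumes p: "p ` S = P" and q: "q ` S = Q" and e: "e \<in> S"
    and fibres: "\<And>x y. x \<in> S \<Longrightarrow> y \<in> S \<Longrightarrow> p x = p y \<longleftrightarrow> q x = q y"
  shows "\<exists>!\<Phi>. \<Phi> \<in> extensional P \<and> pointed_iso \<Phi> P (p e) Q (q e) \<and> (\<forall>x\<in>S. \<Phi> (p x) = q x)"
proof (rule ex1I)
  let ?\<Phi> = "\<lambda>c\<in>P. q (inv_into S p c)"
  have \<Phi>: "?\<Phi> (p x) = q x" if "x \<in> S" for x
  proof -
    have "p x \<in> p ` S" using that by blast
    then have "inv_into S p (p x) \<in> S" "p (inv_into S p (p x)) = p x"
      by (rule inv_into_into, rule f_inv_into_f)
    then show ?thesis
      using fibres[of "inv_into S p (p x)" x] that p by auto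
  qed
  have "bij_betw ?\<Phi> P Q"
  proof (rule bij_betwI')
    fix c d assume "c \<in> P" "d \<in> P"
    then obtain x y where "x \<in> S" "c = p x" "y \<in> S" "d = p y"
      using p by blast
    then show "?\<Phi> c = ?\<Phi> d \<longleftrightarrow> c = d"
      using fibres by (simp only: \<Phi>)
  next
    fix c assume "c \<in> P"
    then obtain x where "x \<in> S" "c = p x"
      using p by blast
    then show "?\<Phi> c \<in> Q"
      using q by (simp only: \<Phi>) blast
  next
    fix d assume "d \<in> Q"
    then obtain x where "x \<in> S" "d = q x"
      using q by blast
    then show "\<exists>c\<in>P. d = ?\<Phi> c"
      using \<Phi>[of x] p by (intro bexI[of _ "p x"]) auto
  qed
  then show "?\<Phi> \<in> extensional P \<and> pointed_iso ?\<Phi> P (p e) Q (q e) \<and> (\<forall>x\<in>S. ?\<Phi> (p x) = q x)"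
    using \<Phi> e p q unfolding pointed_iso_def by (intro conjI ballI) auto
next
  fix \<Psi> assume \<Psi>: "\<Psi> \<in> extensional P \<and> pointed_iso \<Psi> P (p e) Q (q e) \<and> (\<forall>x\<in>S. \<Psi> (p x) = q x)"
  show "\<Psi> = (\<lambda>c\<in>P. q (inv_into S p c))"
  proof (rule extensionalityI[of _ P])
    fix c assume c: "c \<in> P"
    then have "c \<in> p ` S" using p by simp
    then have "inv_into S p c \<in> S" and pc: "p (inv_into S p c) = c"
      by (rule inv_into_into, rule f_inv_into_f)
    then have "\<Psi> (p (inv_into S p c)) = q (inv_into S p c)"
      using \<Psi> by blast
    then show "\<Psi> c = (\<lambda>c\<in>P. q (inv_into S p c)) c"
      using c unfolding pc by simp
  qed (use \<Psi> in auto)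
qed

section \<open>Twisting the inclusion by cocycles\<close>

locale subgroup_of_rational_points = algebraic_group_over_sep_closure L K G
  for L :: "'a ring" (structure) and K and G :: "('a, 'a, 'g) alg_functor" +
  fixes H :: "'g set"
  assumes H: "subgroup H GK"
begin

abbreviation "T \<equiv> krull_topology L K"
abbreviation "Z \<equiv> cent_group L K G H"
abbreviation "cob \<equiv> coboundary L K G"
abbreviation "cocZ \<equiv> cocycles \<Gamma> T Z act"
abbreviation "cocG \<equiv> cocycles \<Gamma> T GL act"
abbreviation "cohZ \<equiv> cohomologous \<Gamma> T Z act"
abbreviation "cohG \<equiv> cohomologous \<Gamma> T GL act"
abbreviation "is_conj \<equiv> is_conjugate_of_incl L K G H"

sublocale GL: group GL by (rule group_GL)
sublocale GK: group GK by (rule group_GK)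
sublocale r: group_hom GK GL r by unfold_locales (rule r_hom)

lemma act_group_hom:
  assumes "\<sigma> \<in> carrier \<Gamma>"
  shows "group_hom GL GL (act \<sigma>)"
  by unfold_locales (rule act_hom[OF assms])

lemma act_closed [simp]: "\<sigma> \<in> carrier \<Gamma> \<Longrightarrow> x \<in> carrier GL \<Longrightarrow> act \<sigma> x \<in> carrier GL"
  using group_hom.hom_closed[OF act_group_hom] .

lemma act_distrib [simp]:
  "\<sigma> \<in> carrier \<Gamma> \<Longrightarrow> x \<in> carrier GL \<Longrightarrow> y \<in> carrier GL \<Longrightarrow> act \<sigma> (x \<otimes>\<^bsub>GL\<^esub> y) = act \<sigma> x \<otimes>\<^bsub>GL\<^esub> act \<sigma> y"
  using group_hom.hom_mult[OF act_group_hom] .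

lemma act_inv [simp]:
  "\<sigma> \<in> carrier \<Gamma> \<Longrightarrow> x \<in> carrier GL \<Longrightarrow> act \<sigma> (inv\<^bsub>GL\<^esub> x) = inv\<^bsub>GL\<^esub> (act \<sigma> x)"
  using group_hom.hom_inv[OF act_group_hom] .

lemma act_one [simp]: "\<sigma> \<in> carrier \<Gamma> \<Longrightarrow> act \<sigma> \<one>\<^bsub>GL\<^esub> = \<one>\<^bsub>GL\<^esub>"
  using group_hom.hom_one[OF act_group_hom] .

lemma H_GK: "h \<in> H \<Longrightarrow> h \<in> carrier GK"
  using subgroup.mem_carrier[OF H] .

lemma rH_GL [simp]: "h \<in> H \<Longrightarrow> r h \<in> carrier GL"
  using H_GK r.hom_closed by blast

lemma act_rH [simp]: "\<sigma> \<in> carrier \<Gamma> \<Longrightarrow> h \<in> H \<Longrightarrow> act \<sigma> (r h) = r h"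
  using act_r H_GK by blast

lemma Z_simps [simp]: "mult Z = mult GL" "one Z = one GL"
  by (simp_all add: cent_group_def)

lemma carrier_Z: "z \<in> carrier Z \<longleftrightarrow> z \<in> carrier GL \<and> (\<forall>h\<in>H. z \<otimes>\<^bsub>GL\<^esub> r h = r h \<otimes>\<^bsub>GL\<^esub> z)"
  by (auto simp: cent_group_def centralizer_def)

lemma Z_subgroup: "subgroup (carrier Z) GL"
  using GL.subgroup_centralizer[of "r ` H"] by (simp add: cent_group_def image_subset_iff)

lemma group_Z: "group Z"
  using GL.subgroup_imp_group[OF Z_subgroup] by (simp add: cent_group_def)

lemma inv_Z: "z \<in> carrier Z \<Longrightarrow> inv\<^bsub>Z\<^esub> z = inv\<^bsub>GL\<^esub> z"
  using GL.m_inv_consistent[OF Z_subgroup] by (simp add: cent_group_def)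

lemma act_hom_Z:
  assumes \<sigma>: "\<sigma> \<in> carrier \<Gamma>"
  shows "act \<sigma> \<in> hom Z Z"
proof (rule homI)
  fix z assume z: "z \<in> carrier Z"
  have "act \<sigma> z \<otimes>\<^bsub>GL\<^esub> r h = r h \<otimes>\<^bsub>GL\<^esub> act \<sigma> z" if h: "h \<in> H" for h
  proof -
    have zG: "z \<in> carrier GL" and comm: "z \<otimes>\<^bsub>GL\<^esub> r h = r h \<otimes>\<^bsub>GL\<^esub> z"
      using z h by (simp_all add: carrier_Z)
    have "act \<sigma> z \<otimes>\<^bsub>GL\<^esub> r h = act \<sigma> (z \<otimes>\<^bsub>GL\<^esub> r h)"
      using \<sigma> h zG by simp
    also have "\<dots> = r h \<otimes>\<^bsub>GL\<^esub> act \<sigma> z"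
      unfolding comm using \<sigma> h zG by simp
    finally show ?thesis .
  qed
  then show "act \<sigma> z \<in> carrier Z"
    using \<sigma> z by (simp add: carrier_Z)
qed (use \<sigma> in \<open>simp add: carrier_Z\<close>)

lemma equiv_cohG: "equiv cocG cohG" and equiv_cohZ: "equiv cocZ cohZ"
  by (rule equiv_cohomologous[OF group_GL], rule act_hom, assumption,
      rule equiv_cohomologous[OF group_Z], rule act_hom_Z)

lemma trans_cohG: "trans cohG"
  using equiv_cohG by (rule equivE)

lemma topspace_krull: "topspace T = carrier \<Gamma>"
proof -
  have "finite_dimension K K"
    using finite_dimensionI[OF dimension_one[OF K_subfield]] .
  then have "\<sigma> \<in> topspace T" if "\<sigma> \<in> carrier \<Gamma>" for \<sigma>
    unfolding krull_topology_def topology_generated_by_topspace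
    using that K_subfield by blast
  then show ?thesis
    unfolding krull_topology_def topology_generated_by_topspace by blast
qed

text \<open>The target \<open>S\<close> is left open because the same cocycle is used with values in \<open>G(L)\<close> and in \<open>Z\<close>.\<close>

lemma continuous_coboundary:
  assumes g: "g \<in> carrier GL" and S: "cob g \<in> carrier \<Gamma> \<rightarrow> S"
  shows "continuous_map T (discrete_topology S) (cob g)"
proof -
  obtain F where F: "subfield F L" "K \<subseteq> F" "finite_dimension K F"
    and eq: "\<And>\<sigma> \<tau>. \<sigma> \<in> carrier \<Gamma> \<Longrightarrow> \<tau> \<in> carrier \<Gamma> \<Longrightarrow> (\<And>a. a \<in> F \<Longrightarrow> \<sigma> a = \<tau> a) \<Longrightarrow> act \<sigma> g = act \<tau> g"
    using orbit_map_locally_constant[OF g] by blast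
  have "openin T {\<sigma> \<in> carrier \<Gamma>. cob g \<sigma> \<in> U}" for U
  proof (subst openin_subopen, intro ballI)
    fix \<sigma> assume \<sigma>: "\<sigma> \<in> {\<sigma> \<in> carrier \<Gamma>. cob g \<sigma> \<in> U}"
    let ?V = "{\<tau> \<in> carrier \<Gamma>. \<forall>x\<in>F. \<tau> x = \<sigma> x}"
    have "openin T ?V"
      unfolding krull_topology_def using \<sigma> F by (intro topology_generated_by_Basis) blast
    moreover have "?V \<subseteq> {\<sigma> \<in> carrier \<Gamma>. cob g \<sigma> \<in> U}"
    proof
      fix \<tau> assume \<tau>: "\<tau> \<in> ?V"
      then have "act \<tau> g = act \<sigma> g"
        using eq[of \<tau> \<sigma>] \<sigma> by blast
      then have "cob g \<tau> = cob g \<sigma>"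
        using \<sigma> \<tau> by (simp add: coboundary_def)
      then show "\<tau> \<in> {\<sigma> \<in> carrier \<Gamma>. cob g \<sigma> \<in> U}"
        using \<sigma> \<tau> by simp
    qed
    ultimately show "\<exists>V. openin T V \<and> \<sigma> \<in> V \<and> V \<subseteq> {\<sigma> \<in> carrier \<Gamma>. cob g \<sigma> \<in> U}"
      using \<sigma> by blast
  qed
  then show ?thesis
    using S by (auto simp: continuous_map_def topspace_krull)
qed

lemma cob_cocycle_identity:
  assumes "g \<in> carrier GL" "\<sigma> \<in> carrier \<Gamma>" "\<tau> \<in> carrier \<Gamma>"
  shows "cob g (\<sigma> \<otimes>\<^bsub>\<Gamma>\<^esub> \<tau>) = cob g \<sigma> \<otimes>\<^bsub>GL\<^esub> act \<sigma> (cob g \<tau>)"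
  using assms galois_mult(2)[of \<sigma> \<tau>] act_mult[of \<sigma> \<tau> g]
  by (simp add: coboundary_def GL.m_assoc)

lemma cob_closed: "g \<in> carrier GL \<Longrightarrow> \<sigma> \<in> carrier \<Gamma> \<Longrightarrow> cob g \<sigma> \<in> carrier GL"
  by (simp add: coboundary_def)

lemma cob_cocG:
  assumes "g \<in> carrier GL"
  shows "cob g \<in> cocG"
proof -
  have "cob g \<in> carrier \<Gamma> \<rightarrow>\<^sub>E carrier GL"
    using cob_closed[OF assms] by (auto simp: coboundary_def)
  then show ?thesis
    using continuous_coboundary[OF assms, of "carrier GL"] cob_cocycle_identity[OF assms]
    unfolding cocycles_def by auto
qed

text \<open>The elements whose coboundary is a cocycle in \<open>Z\<close>. Both pointed sets of the theorem turn out to be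
  the set of double cosets \<open>G(K) g Z\<close> of such elements.\<close>

definition twists :: "'g set" where
  "twists = {g \<in> carrier GL. \<forall>\<sigma>\<in>carrier \<Gamma>. cob g \<sigma> \<in> carrier Z}"

lemma twistsD: "g \<in> twists \<Longrightarrow> g \<in> carrier GL" "g \<in> twists \<Longrightarrow> \<sigma> \<in> carrier \<Gamma> \<Longrightarrow> cob g \<sigma> \<in> carrier Z"
  by (simp_all add: twists_def)

lemma cob_cocZ_iff:
  assumes "g \<in> carrier GL"
  shows "cob g \<in> cocZ \<longleftrightarrow> g \<in> twists"
proof
  assume "cob g \<in> cocZ"
  then show "g \<in> twists"
    using assms by (auto simp: cocycles_def twists_def)
next
  assume g: "g \<in> twists"
  then have "cob g \<in> carrier \<Gamma> \<rightarrow>\<^sub>E carrier Z"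
    using twistsD(2) by (auto simp: coboundary_def)
  then show "cob g \<in> cocZ"
    using continuous_coboundary[OF assms, of "carrier Z"] cob_cocycle_identity[OF assms]
    unfolding cocycles_def by auto
qed

lemma cocZ_cocG:
  assumes a: "a \<in> cocZ"
  shows "a \<in> cocG"
proof -
  have sub: "carrier Z \<subseteq> carrier GL" by (auto simp: carrier_Z)
  have "continuous_map T (discrete_topology (carrier GL)) a"
    unfolding continuous_map_def
  proof (intro conjI allI impI)
    show "a \<in> topspace T \<rightarrow> topspace (discrete_topology (carrier GL))"
      using a sub by (auto simp: cocycles_def topspace_krull)
    fix U
    have "{\<sigma> \<in> topspace T. a \<sigma> \<in> U} = {\<sigma> \<in> topspace T. a \<sigma> \<in> U \<inter> carrier Z}"
      using a by (auto simp: cocycles_def topspace_krull)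
    moreover have "openin T {\<sigma> \<in> topspace T. a \<sigma> \<in> V}" if "V \<subseteq> carrier Z" for V
      using a that by (simp add: cocycles_def continuous_map_def)
    from this[OF Int_lower2] have "openin T {\<sigma> \<in> topspace T. a \<sigma> \<in> U \<inter> carrier Z}" .
    ultimately show "openin T {\<sigma> \<in> topspace T. a \<sigma> \<in> U}" by simp
  qed
  then show ?thesis
    using a sub by (auto simp: cocycles_def)
qed

lemma cohZ_cohG:
  assumes "(a, a') \<in> cohZ"
  shows "(a, a') \<in> cohG"
proof -
  from assms obtain b where b: "b \<in> carrier Z" and a: "a \<in> cocZ" "a' \<in> cocZ"
    and eq: "\<forall>\<sigma>\<in>carrier \<Gamma>. a' \<sigma> = inv\<^bsub>Z\<^esub> b \<otimes>\<^bsub>Z\<^esub> a \<sigma> \<otimes>\<^bsub>Z\<^esub> act \<sigma> b"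
    unfolding cohomologous_def by blast
  have "b \<in> carrier GL" "\<forall>\<sigma>\<in>carrier \<Gamma>. a' \<sigma> = inv\<^bsub>GL\<^esub> b \<otimes>\<^bsub>GL\<^esub> a \<sigma> \<otimes>\<^bsub>GL\<^esub> act \<sigma> b"
    using b eq by (auto simp: inv_Z carrier_Z)
  then show ?thesis
    using cocZ_cocG[OF a(1)] cocZ_cocG[OF a(2)] unfolding cohomologous_def by blast
qed

lemma cob_one: "cob \<one>\<^bsub>GL\<^esub> = (\<lambda>\<sigma>\<in>carrier \<Gamma>. \<one>\<^bsub>GL\<^esub>)"
  unfolding coboundary_def by (intro restrict_ext) simp

lemma one_twists: "\<one>\<^bsub>GL\<^esub> \<in> twists"
  by (simp add: twists_def cob_one carrier_Z)

text \<open>The witness is \<open>g\<^sup>-\<^sup>1 g'\<close>.\<close>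

lemma cobs_cohG:
  assumes g: "g \<in> carrier GL" and g': "g' \<in> carrier GL"
  shows "(cob g, cob g') \<in> cohG"
proof -
  have "cob g' \<sigma> = inv\<^bsub>GL\<^esub> (inv\<^bsub>GL\<^esub> g \<otimes>\<^bsub>GL\<^esub> g') \<otimes>\<^bsub>GL\<^esub> cob g \<sigma> \<otimes>\<^bsub>GL\<^esub> act \<sigma> (inv\<^bsub>GL\<^esub> g \<otimes>\<^bsub>GL\<^esub> g')"
    if "\<sigma> \<in> carrier \<Gamma>" for \<sigma>
    using that g g' by (simp add: coboundary_def GL.m_assoc GL.inv_mult_group)
  then show ?thesis
    using cob_cocG[OF g] cob_cocG[OF g'] g g' unfolding cohomologous_def by blast
qed

text \<open>Solving \<open>1 = b\<^sup>-\<^sup>1 a\<^sub>\<sigma> \<sigma>b\<close> for \<open>a\<^sub>\<sigma>\<close> gives the coboundary of \<open>b\<^sup>-\<^sup>1\<close>.\<close>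

lemma cohG_one_imp_cob:
  assumes "(a, cob \<one>\<^bsub>GL\<^esub>) \<in> cohG"
  obtains g where "g \<in> carrier GL" "a = cob g"
proof -
  from assms obtain b where b: "b \<in> carrier GL" and a: "a \<in> cocG"
    and eq: "\<And>\<sigma>. \<sigma> \<in> carrier \<Gamma> \<Longrightarrow> cob \<one>\<^bsub>GL\<^esub> \<sigma> = inv\<^bsub>GL\<^esub> b \<otimes>\<^bsub>GL\<^esub> a \<sigma> \<otimes>\<^bsub>GL\<^esub> act \<sigma> b"
    unfolding cohomologous_def by blast
  have "a \<sigma> = cob (inv\<^bsub>GL\<^esub> b) \<sigma>" if \<sigma>: "\<sigma> \<in> carrier \<Gamma>" for \<sigma>
  proof -
    have a\<sigma>: "a \<sigma> \<in> carrier GL" using a \<sigma> by (auto simp: cocycles_def)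
    have "b \<otimes>\<^bsub>GL\<^esub> \<one>\<^bsub>GL\<^esub> \<otimes>\<^bsub>GL\<^esub> inv\<^bsub>GL\<^esub> (act \<sigma> b)
        = b \<otimes>\<^bsub>GL\<^esub> (inv\<^bsub>GL\<^esub> b \<otimes>\<^bsub>GL\<^esub> a \<sigma> \<otimes>\<^bsub>GL\<^esub> act \<sigma> b) \<otimes>\<^bsub>GL\<^esub> inv\<^bsub>GL\<^esub> (act \<sigma> b)"
      using eq[OF \<sigma>] \<sigma> by (simp add: cob_one)
    also have "\<dots> = a \<sigma>"
      using a\<sigma> b \<sigma> by (simp add: GL.m_assoc)
    finally show ?thesis
      using b \<sigma> by (simp add: coboundary_def)
  qed
  moreover have "a \<in> extensional (carrier \<Gamma>)" "cob (inv\<^bsub>GL\<^esub> b) \<in> extensional (carrier \<Gamma>)"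
    using a by (auto simp: cocycles_def coboundary_def PiE_def)
  ultimately have "a = cob (inv\<^bsub>GL\<^esub> b)"
    by (intro extensionalityI)
  then show thesis
    using that[of "inv\<^bsub>GL\<^esub> b"] b by simp
qed

lemma H1_map_class:
  assumes "c \<in> cocZ // cohZ"
  shows "H1_map \<Gamma> T GL act (\<lambda>z. z) c = cohG `` c"
proof -
  have "c \<subseteq> cocZ"
    by (rule in_quotient_imp_subset[OF equiv_cohZ assms])
  then have "compose (carrier \<Gamma>) (\<lambda>z. z) a = a" if "a \<in> c" for a
    using that by (auto simp: cocycles_def compose_def extensional_def fun_eq_iff PiE_def)
  then have "compose (carrier \<Gamma>) (\<lambda>z. z) ` c = c"
    by simp
  then show ?thesis
    unfolding H1_map_def by simp
qed

text \<open>A class of \<open>Z\<close>-cocycles lies in the kernel iff it contains a coboundary of \<open>G(L)\<close>, and the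
  coboundaries with values in \<open>Z\<close> are by definition those of twists.\<close>

lemma kerH1_eq: "kerH1 L K G H = (\<lambda>g. cohZ `` {cob g}) ` twists"
proof (intro equalityI subsetI)
  fix c assume c: "c \<in> kerH1 L K G H"
  then have cq: "c \<in> cocZ // cohZ" and ker: "cohG `` c = cohG `` {cob \<one>\<^bsub>GL\<^esub>}"
    using H1_map_class unfolding kerH1_def H1_def H1_base_def cob_one by auto
  have "cob \<one>\<^bsub>GL\<^esub> \<in> cohG `` c"
    unfolding ker using equiv_class_self[OF equiv_cohG cob_cocG] by simp
  then obtain a where a: "a \<in> c" "(a, cob \<one>\<^bsub>GL\<^esub>) \<in> cohG"
    by blast
  then obtain g where g: "g \<in> carrier GL" "a = cob g"
    using cohG_one_imp_cob by blast
  have "cob g \<in> cocZ"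
    using in_quotient_imp_subset[OF equiv_cohZ cq] a(1) unfolding g(2) by blast
  then have "g \<in> twists"
    using cob_cocZ_iff[OF g(1)] by simp
  moreover have "c = cohZ `` {cob g}"
  proof -
    obtain x where x: "c = cohZ `` {x}"
      using cq by (rule quotientE)
    then have "(x, cob g) \<in> cohZ"
      using a(1) unfolding g(2) by simp
    then show ?thesis
      unfolding x by (rule equiv_class_eq[OF equiv_cohZ])
  qed
  ultimately show "c \<in> (\<lambda>g. cohZ `` {cob g}) ` twists"
    by blast
next
  fix c assume "c \<in> (\<lambda>g. cohZ `` {cob g}) ` twists"
  then obtain g where g: "g \<in> twists" and c: "c = cohZ `` {cob g}"
    by blast
  have gG: "g \<in> carrier GL" and gZ: "cob g \<in> cocZ"
    using twistsD(1)[OF g] cob_cocZ_iff g by auto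
  have cq: "c \<in> cocZ // cohZ"
    unfolding c using gZ by (rule quotientI)
  have "cohG `` c = cohG `` {cob \<one>\<^bsub>GL\<^esub>}"
  proof (intro equalityI subsetI)
    fix a assume "a \<in> cohG `` c"
    then obtain a' where "(cob g, a') \<in> cohG" "(a', a) \<in> cohG"
      unfolding c using cohZ_cohG by blast
    then have "(cob \<one>\<^bsub>GL\<^esub>, a) \<in> cohG"
      using cobs_cohG[OF GL.one_closed gG] trans_cohG by (blast dest: transD)
    then show "a \<in> cohG `` {cob \<one>\<^bsub>GL\<^esub>}" by simp
  next
    fix a assume "a \<in> cohG `` {cob \<one>\<^bsub>GL\<^esub>}"
    then have "(cob g, a) \<in> cohG"
      using cobs_cohG[OF gG GL.one_closed] trans_cohG by (blast dest: transD)
    moreover have "cob g \<in> c"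
      unfolding c using equiv_class_self[OF equiv_cohZ gZ] .
    ultimately show "a \<in> cohG `` c" by blast
  qed
  then show "c \<in> kerH1 L K G H"
    using cq H1_map_class[OF cq] unfolding kerH1_def H1_def H1_base_def cob_one by simp
qed

text \<open>Apply \<open>\<sigma>\<close> to the invariant element \<open>g h g\<^sup>-\<^sup>1\<close>: then \<open>g\<close> and \<open>\<sigma> g\<close> conjugate \<open>h\<close> to the same element,
  so \<open>g\<^sup>-\<^sup>1 \<sigma>g\<close> commutes with \<open>h\<close>.\<close>

lemma conj_twists:
  assumes g: "g \<in> carrier GL" and \<phi>: "\<phi> \<in> H \<rightarrow> carrier GK" "is_conj g \<phi>"
  shows "g \<in> twists"
proof -
  have "cob g \<sigma> \<otimes>\<^bsub>GL\<^esub> r h = r h \<otimes>\<^bsub>GL\<^esub> cob g \<sigma>" if \<sigma>: "\<sigma> \<in> carrier \<Gamma>" and h: "h \<in> H" for \<sigma> h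
  proof -
    have eq: "r (\<phi> h) = g \<otimes>\<^bsub>GL\<^esub> r h \<otimes>\<^bsub>GL\<^esub> inv\<^bsub>GL\<^esub> g"
      using \<phi>(2) h by (simp add: is_conjugate_of_incl_def)
    have "act \<sigma> (r (\<phi> h)) = r (\<phi> h)"
      using act_r[OF \<sigma>] \<phi>(1) h by blast
    then have "act \<sigma> g \<otimes>\<^bsub>GL\<^esub> r h \<otimes>\<^bsub>GL\<^esub> inv\<^bsub>GL\<^esub> (act \<sigma> g) = g \<otimes>\<^bsub>GL\<^esub> r h \<otimes>\<^bsub>GL\<^esub> inv\<^bsub>GL\<^esub> g"
      unfolding eq using g \<sigma> h by simp
    then have "inv\<^bsub>GL\<^esub> g \<otimes>\<^bsub>GL\<^esub> (act \<sigma> g \<otimes>\<^bsub>GL\<^esub> r h \<otimes>\<^bsub>GL\<^esub> inv\<^bsub>GL\<^esub> (act \<sigma> g)) \<otimes>\<^bsub>GL\<^esub> act \<sigma> g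
        = inv\<^bsub>GL\<^esub> g \<otimes>\<^bsub>GL\<^esub> (g \<otimes>\<^bsub>GL\<^esub> r h \<otimes>\<^bsub>GL\<^esub> inv\<^bsub>GL\<^esub> g) \<otimes>\<^bsub>GL\<^esub> act \<sigma> g"
      by simp
    then show ?thesis
      using g \<sigma> h by (simp add: coboundary_def GL.m_assoc)
  qed
  then show ?thesis
    using g cob_closed[OF g] by (simp add: twists_def carrier_Z)
qed

text \<open>For a twist \<open>g\<close> this is the embedding \<open>g i g\<^sup>-\<^sup>1\<close> of \<open>H\<close> into \<open>G(K)\<close>: conjugation happens in \<open>G(L)\<close>,
  and the result is pulled back along \<open>r\<close>.\<close>

definition twisted_incl :: "'g \<Rightarrow> 'g \<Rightarrow> 'g" where
  "twisted_incl g = (\<lambda>h\<in>H. inv_into (carrier GK) r (g \<otimes>\<^bsub>GL\<^esub> r h \<otimes>\<^bsub>GL\<^esub> inv\<^bsub>GL\<^esub> g))"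

text \<open>The converse of \<open>conj_twists\<close>: if \<open>g\<^sup>-\<^sup>1 \<sigma>g\<close> commutes with \<open>h\<close>, then \<open>g h g\<^sup>-\<^sup>1\<close> is Galois invariant,
  hence rational.\<close>

lemma twisted_incl:
  assumes g: "g \<in> twists"
  shows "\<And>h. h \<in> H \<Longrightarrow> twisted_incl g h \<in> carrier GK" "is_conj g (twisted_incl g)"
proof -
  note gG = twistsD(1)[OF g]
  have "g \<otimes>\<^bsub>GL\<^esub> r h \<otimes>\<^bsub>GL\<^esub> inv\<^bsub>GL\<^esub> g \<in> r ` carrier GK" if h: "h \<in> H" for h
  proof (rule fixed_points_rational)
    show "g \<otimes>\<^bsub>GL\<^esub> r h \<otimes>\<^bsub>GL\<^esub> inv\<^bsub>GL\<^esub> g \<in> carrier GL"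
      using gG h by simp
    fix \<sigma> assume \<sigma>: "\<sigma> \<in> carrier \<Gamma>"
    have z: "cob g \<sigma> \<otimes>\<^bsub>GL\<^esub> r h = r h \<otimes>\<^bsub>GL\<^esub> cob g \<sigma>"
      using twistsD(2)[OF g \<sigma>] h by (simp add: carrier_Z)
    then have "g \<otimes>\<^bsub>GL\<^esub> (cob g \<sigma> \<otimes>\<^bsub>GL\<^esub> r h) \<otimes>\<^bsub>GL\<^esub> inv\<^bsub>GL\<^esub> (act \<sigma> g)
       = g \<otimes>\<^bsub>GL\<^esub> (r h \<otimes>\<^bsub>GL\<^esub> cob g \<sigma>) \<otimes>\<^bsub>GL\<^esub> inv\<^bsub>GL\<^esub> (act \<sigma> g)"
      by simp
    then show "act \<sigma> (g \<otimes>\<^bsub>GL\<^esub> r h \<otimes>\<^bsub>GL\<^esub> inv\<^bsub>GL\<^esub> g) = g \<otimes>\<^bsub>GL\<^esub> r h \<otimes>\<^bsub>GL\<^esub> inv\<^bsub>GL\<^esub> g"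
      using gG h \<sigma> by (simp add: coboundary_def GL.m_assoc)
  qed
  then show "\<And>h. h \<in> H \<Longrightarrow> twisted_incl g h \<in> carrier GK" "is_conj g (twisted_incl g)"
    by (simp_all add: twisted_incl_def is_conjugate_of_incl_def inv_into_into f_inv_into_f)
qed

lemma conj_unique:
  assumes g: "g \<in> twists" and \<phi>: "\<phi> \<in> H \<rightarrow> carrier GK" "\<phi> \<in> extensional H" "is_conj g \<phi>"
  shows "\<phi> = twisted_incl g"
proof (rule extensionalityI[OF \<phi>(2)])
  show "twisted_incl g \<in> extensional H" by (simp add: twisted_incl_def)
  fix h assume h: "h \<in> H"
  have "r (\<phi> h) = r (twisted_incl g h)"
    using \<phi>(3) twisted_incl(2)[OF g] h by (simp add: is_conjugate_of_incl_def)
  then show "\<phi> h = twisted_incl g h"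
    using inj_onD[OF r_inj] \<phi>(1) twisted_incl(1)[OF g h] h by blast
qed

lemma conj_embeddings_eq: "conj_embeddings L K G H = twisted_incl ` twists"
proof (intro equalityI subsetI)
  fix \<phi> assume "\<phi> \<in> conj_embeddings L K G H"
  then obtain g where \<phi>: "\<phi> \<in> H \<rightarrow> carrier GK" "\<phi> \<in> extensional H" and g: "g \<in> carrier GL" "is_conj g \<phi>"
    unfolding conj_embeddings_def by (auto simp: hom_def)
  have "g \<in> twists"
    using conj_twists[OF g(1) \<phi>(1) g(2)] .
  then show "\<phi> \<in> twisted_incl ` twists"
    using conj_unique[OF _ \<phi> g(2)] by blast
next
  fix \<phi> assume "\<phi> \<in> twisted_incl ` twists"
  then obtain g where g: "g \<in> twists" and \<phi>: "\<phi> = twisted_incl g" by blast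
  note gG = twistsD(1)[OF g]
  have r\<phi>: "r (\<phi> h) = g \<otimes>\<^bsub>GL\<^esub> r h \<otimes>\<^bsub>GL\<^esub> inv\<^bsub>GL\<^esub> g" if "h \<in> H" for h
    using twisted_incl(2)[OF g] that by (simp add: \<phi> is_conjugate_of_incl_def)
  have \<phi>K: "\<phi> h \<in> carrier GK" if "h \<in> H" for h
    using twisted_incl(1)[OF g that] by (simp add: \<phi>)
  have "\<phi> \<in> hom (GK\<lparr>carrier := H\<rparr>) GK"
  proof (rule homI; simp add: \<phi>K)
    fix h h' assume h: "h \<in> H" "h' \<in> H"
    then have hh: "h \<otimes>\<^bsub>GK\<^esub> h' \<in> H"
      using subgroup.m_closed[OF H] by blast
    have "r (\<phi> (h \<otimes>\<^bsub>GK\<^esub> h')) = r (\<phi> h \<otimes>\<^bsub>GK\<^esub> \<phi> h')"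
      using h hh gG \<phi>K H_GK by (simp add: r\<phi> GL.m_assoc)
    then show "\<phi> (h \<otimes>\<^bsub>GK\<^esub> h') = \<phi> h \<otimes>\<^bsub>GK\<^esub> \<phi> h'"
      using inj_onD[OF r_inj] \<phi>K hh h by simp
  qed
  moreover have "inj_on \<phi> H"
  proof (rule inj_onI)
    fix h h' assume h: "h \<in> H" "h' \<in> H" and "\<phi> h = \<phi> h'"
    then have "g \<otimes>\<^bsub>GL\<^esub> r h \<otimes>\<^bsub>GL\<^esub> inv\<^bsub>GL\<^esub> g = g \<otimes>\<^bsub>GL\<^esub> r h' \<otimes>\<^bsub>GL\<^esub> inv\<^bsub>GL\<^esub> g"
      using r\<phi> by metis
    then have "r h = r h'"
      using gG h by simp
    then show "h = h'"
      using inj_onD[OF r_inj] H_GK h by blast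
  qed
  moreover have "\<phi> \<in> extensional H"
    by (simp add: \<phi> twisted_incl_def)
  ultimately show "\<phi> \<in> conj_embeddings L K G H"
    using gG twisted_incl(2)[OF g] unfolding conj_embeddings_def \<phi> by blast
qed

text \<open>The coboundary of \<open>g z\<close> is that of \<open>g\<close> modified by \<open>z\<close>, and two elements have the same coboundary
  iff they differ on the left by an invariant, that is, rational, element.\<close>

lemma cohZ_cob_iff:
  assumes g: "g \<in> twists" and g': "g' \<in> twists"
  shows "(cob g, cob g') \<in> cohZ \<longleftrightarrow> (\<exists>k\<in>carrier GK. \<exists>z\<in>carrier Z. g' = r k \<otimes>\<^bsub>GL\<^esub> g \<otimes>\<^bsub>GL\<^esub> z)"
proof
  note G = twistsD(1)[OF g] twistsD(1)[OF g']
  assume "(cob g, cob g') \<in> cohZ"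
  then obtain z where z: "z \<in> carrier Z"
    and eq: "\<And>\<sigma>. \<sigma> \<in> carrier \<Gamma> \<Longrightarrow> cob g' \<sigma> = inv\<^bsub>Z\<^esub> z \<otimes>\<^bsub>Z\<^esub> cob g \<sigma> \<otimes>\<^bsub>Z\<^esub> act \<sigma> z"
    unfolding cohomologous_def by blast
  have zG: "z \<in> carrier GL" using z by (simp add: carrier_Z)
  let ?x = "g' \<otimes>\<^bsub>GL\<^esub> inv\<^bsub>GL\<^esub> (g \<otimes>\<^bsub>GL\<^esub> z)"
  have "?x \<in> r ` carrier GK"
  proof (rule fixed_points_rational)
    show "?x \<in> carrier GL" using G zG by simp
    fix \<sigma> assume \<sigma>: "\<sigma> \<in> carrier \<Gamma>"
    have "act \<sigma> g' = g' \<otimes>\<^bsub>GL\<^esub> cob g' \<sigma>"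
      using \<sigma> G by (simp add: coboundary_def)
    also have "\<dots> = g' \<otimes>\<^bsub>GL\<^esub> (inv\<^bsub>GL\<^esub> z \<otimes>\<^bsub>GL\<^esub> (inv\<^bsub>GL\<^esub> g \<otimes>\<^bsub>GL\<^esub> act \<sigma> g) \<otimes>\<^bsub>GL\<^esub> act \<sigma> z)"
      using eq[OF \<sigma>] \<sigma> z by (simp add: inv_Z) (simp add: coboundary_def)
    finally have "act \<sigma> g' = \<dots>" .
    then show "act \<sigma> ?x = ?x"
      using \<sigma> G zG by (simp add: GL.m_assoc GL.inv_mult_group)
  qed
  then obtain k where k: "k \<in> carrier GK" "r k = ?x" by auto
  have "g' = r k \<otimes>\<^bsub>GL\<^esub> g \<otimes>\<^bsub>GL\<^esub> z"
    unfolding k(2) using G zG by (simp add: GL.m_assoc GL.inv_mult_group)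
  then show "\<exists>k\<in>carrier GK. \<exists>z\<in>carrier Z. g' = r k \<otimes>\<^bsub>GL\<^esub> g \<otimes>\<^bsub>GL\<^esub> z"
    using k(1) z by blast
next
  note G = twistsD(1)[OF g] twistsD(1)[OF g']
  assume "\<exists>k\<in>carrier GK. \<exists>z\<in>carrier Z. g' = r k \<otimes>\<^bsub>GL\<^esub> g \<otimes>\<^bsub>GL\<^esub> z"
  then obtain k z where k: "k \<in> carrier GK" and z: "z \<in> carrier Z" and eq: "g' = r k \<otimes>\<^bsub>GL\<^esub> g \<otimes>\<^bsub>GL\<^esub> z"
    by blast
  have zG: "z \<in> carrier GL" using z by (simp add: carrier_Z)
  have "cob g' \<sigma> = inv\<^bsub>Z\<^esub> z \<otimes>\<^bsub>Z\<^esub> cob g \<sigma> \<otimes>\<^bsub>Z\<^esub> act \<sigma> z" if \<sigma>: "\<sigma> \<in> carrier \<Gamma>" for \<sigma>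
    using \<sigma> G(1) zG k z act_r[OF \<sigma> k]
    by (simp add: inv_Z) (simp add: eq coboundary_def GL.m_assoc GL.inv_mult_group)
  then show "(cob g, cob g') \<in> cohZ"
    using z cob_cocZ_iff[OF G(1)] cob_cocZ_iff[OF G(2)] g g' unfolding cohomologous_def by blast
qed

text \<open>Conjugation by \<open>g'\<close> agrees on \<open>H\<close> with conjugation by \<open>k g\<close> iff \<open>(k g)\<^sup>-\<^sup>1 g'\<close> centralizes \<open>H\<close>.
  Together with the previous lemma this shows that the two equivalence relations on twists agree.\<close>

lemma rat_conj_iff:
  assumes g: "g \<in> twists" and g': "g' \<in> twists"
  shows "(twisted_incl g, twisted_incl g') \<in> rat_conj L K G H \<longleftrightarrow>
    (\<exists>k\<in>carrier GK. \<exists>z\<in>carrier Z. g' = r k \<otimes>\<^bsub>GL\<^esub> g \<otimes>\<^bsub>GL\<^esub> z)"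
proof -
  note G = twistsD(1)[OF g] twistsD(1)[OF g']
  have r_tw: "r (twisted_incl f h) = f \<otimes>\<^bsub>GL\<^esub> r h \<otimes>\<^bsub>GL\<^esub> inv\<^bsub>GL\<^esub> f" if "f \<in> twists" "h \<in> H" for f h
    using twisted_incl(2)[OF that(1)] that(2) by (simp add: is_conjugate_of_incl_def)
  have "(\<forall>h\<in>H. twisted_incl g' h = k \<otimes>\<^bsub>GK\<^esub> twisted_incl g h \<otimes>\<^bsub>GK\<^esub> inv\<^bsub>GK\<^esub> k) \<longleftrightarrow>
      (\<exists>z\<in>carrier Z. g' = r k \<otimes>\<^bsub>GL\<^esub> g \<otimes>\<^bsub>GL\<^esub> z)" if k: "k \<in> carrier GK" for k
  proof
    assume conjK: "\<forall>h\<in>H. twisted_incl g' h = k \<otimes>\<^bsub>GK\<^esub> twisted_incl g h \<otimes>\<^bsub>GK\<^esub> inv\<^bsub>GK\<^esub> k"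
    let ?z = "inv\<^bsub>GL\<^esub> (r k \<otimes>\<^bsub>GL\<^esub> g) \<otimes>\<^bsub>GL\<^esub> g'"
    have rk: "r k \<in> carrier GL" using k by simp
    have zG: "?z \<in> carrier GL" using G rk by simp
    have "?z \<otimes>\<^bsub>GL\<^esub> r h = r h \<otimes>\<^bsub>GL\<^esub> ?z" if h: "h \<in> H" for h
    proof -
      have "r (twisted_incl g' h) = r (k \<otimes>\<^bsub>GK\<^esub> twisted_incl g h \<otimes>\<^bsub>GK\<^esub> inv\<^bsub>GK\<^esub> k)"
        using conjK h by simp
      then have "g' \<otimes>\<^bsub>GL\<^esub> r h \<otimes>\<^bsub>GL\<^esub> inv\<^bsub>GL\<^esub> g'
          = r k \<otimes>\<^bsub>GL\<^esub> (g \<otimes>\<^bsub>GL\<^esub> r h \<otimes>\<^bsub>GL\<^esub> inv\<^bsub>GL\<^esub> g) \<otimes>\<^bsub>GL\<^esub> inv\<^bsub>GL\<^esub> (r k)"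
        using k h twisted_incl(1)[OF g h] by (simp add: r_tw[OF g h] r_tw[OF g' h])
      then have "inv\<^bsub>GL\<^esub> (r k \<otimes>\<^bsub>GL\<^esub> g) \<otimes>\<^bsub>GL\<^esub> (g' \<otimes>\<^bsub>GL\<^esub> r h \<otimes>\<^bsub>GL\<^esub> inv\<^bsub>GL\<^esub> g') \<otimes>\<^bsub>GL\<^esub> g'
          = inv\<^bsub>GL\<^esub> (r k \<otimes>\<^bsub>GL\<^esub> g) \<otimes>\<^bsub>GL\<^esub> (r k \<otimes>\<^bsub>GL\<^esub> (g \<otimes>\<^bsub>GL\<^esub> r h \<otimes>\<^bsub>GL\<^esub> inv\<^bsub>GL\<^esub> g) \<otimes>\<^bsub>GL\<^esub> inv\<^bsub>GL\<^esub> (r k)) \<otimes>\<^bsub>GL\<^esub> g'"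
        by simp
      then show ?thesis
        using G rk h by (simp add: GL.m_assoc GL.inv_mult_group del: r.hom_inv)
    qed
    then have "?z \<in> carrier Z"
      using zG by (simp add: carrier_Z)
    moreover have "g' = r k \<otimes>\<^bsub>GL\<^esub> g \<otimes>\<^bsub>GL\<^esub> ?z"
      using G rk by (simp add: GL.m_assoc GL.inv_mult_group)
    ultimately show "\<exists>z\<in>carrier Z. g' = r k \<otimes>\<^bsub>GL\<^esub> g \<otimes>\<^bsub>GL\<^esub> z" by blast
  next
    assume "\<exists>z\<in>carrier Z. g' = r k \<otimes>\<^bsub>GL\<^esub> g \<otimes>\<^bsub>GL\<^esub> z"
    then obtain z where z: "z \<in> carrier Z" and eq: "g' = r k \<otimes>\<^bsub>GL\<^esub> g \<otimes>\<^bsub>GL\<^esub> z" by blast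
    have zG: "z \<in> carrier GL" using z by (simp add: carrier_Z)
    show "\<forall>h\<in>H. twisted_incl g' h = k \<otimes>\<^bsub>GK\<^esub> twisted_incl g h \<otimes>\<^bsub>GK\<^esub> inv\<^bsub>GK\<^esub> k"
    proof
      fix h assume h: "h \<in> H"
      have "z \<otimes>\<^bsub>GL\<^esub> r h \<otimes>\<^bsub>GL\<^esub> inv\<^bsub>GL\<^esub> z = r h"
        using z h zG by (simp add: carrier_Z GL.m_assoc)
      then have zh: "z \<otimes>\<^bsub>GL\<^esub> (r h \<otimes>\<^bsub>GL\<^esub> (inv\<^bsub>GL\<^esub> z \<otimes>\<^bsub>GL\<^esub> y)) = r h \<otimes>\<^bsub>GL\<^esub> y" if "y \<in> carrier GL" for y
        using that zG h by (simp add: GL.m_assoc[symmetric])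
      have "r (twisted_incl g' h) = r (k \<otimes>\<^bsub>GK\<^esub> twisted_incl g h \<otimes>\<^bsub>GK\<^esub> inv\<^bsub>GK\<^esub> k)"
        using k h zG G(1) twisted_incl(1)[OF g h]
        by (simp add: r_tw[OF g h] r_tw[OF g' h]) (simp add: eq GL.m_assoc GL.inv_mult_group zh)
      then show "twisted_incl g' h = k \<otimes>\<^bsub>GK\<^esub> twisted_incl g h \<otimes>\<^bsub>GK\<^esub> inv\<^bsub>GK\<^esub> k"
        using inj_onD[OF r_inj] twisted_incl(1)[OF g h] twisted_incl(1)[OF g' h] k by simp
    qed
  qed
  moreover have "twisted_incl g \<in> conj_embeddings L K G H" "twisted_incl g' \<in> conj_embeddings L K G H"
    using g g' conj_embeddings_eq by auto
  ultimately show ?thesis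
    unfolding rat_conj_def by blast
qed

lemma equiv_rat_conj: "equiv (conj_embeddings L K G H) (rat_conj L K G H)"
proof -
  have "(twisted_incl g, twisted_incl g') \<in> rat_conj L K G H \<longleftrightarrow> (cob g, cob g') \<in> cohZ"
    if "g \<in> twists" "g' \<in> twists" for g g'
    using rat_conj_iff[OF that] cohZ_cob_iff[OF that] by simp
  note iff = this
  have cocZ: "cob g \<in> cocZ" if "g \<in> twists" for g
    using cob_cocZ_iff[OF twistsD(1)[OF that]] that by simp
  have sub: "rat_conj L K G H \<subseteq> conj_embeddings L K G H \<times> conj_embeddings L K G H"
    unfolding rat_conj_def by blast
  have E: "refl_on cocZ cohZ" "sym cohZ" "trans cohZ"
    using equiv_cohZ by (auto elim: equivE)
  show ?thesis
  proof (rule equivI)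
    show "rat_conj L K G H \<subseteq> conj_embeddings L K G H \<times> conj_embeddings L K G H" by (rule sub)
    show "refl_on (conj_embeddings L K G H) (rat_conj L K G H)"
    proof (rule refl_onI)
      fix \<phi> assume "\<phi> \<in> conj_embeddings L K G H"
      then obtain g where "g \<in> twists" "\<phi> = twisted_incl g"
        unfolding conj_embeddings_eq by blast
      then show "(\<phi>, \<phi>) \<in> rat_conj L K G H"
        using iff cocZ refl_onD[OF E(1)] by blast
    qed
    show "sym (rat_conj L K G H)"
    proof (rule symI)
      fix \<phi> \<psi> assume a: "(\<phi>, \<psi>) \<in> rat_conj L K G H"
      then obtain g g' where "g \<in> twists" "\<phi> = twisted_incl g" "g' \<in> twists" "\<psi> = twisted_incl g'"
        using sub unfolding conj_embeddings_eq by blast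
      then show "(\<psi>, \<phi>) \<in> rat_conj L K G H"
        using a iff symD[OF E(2)] by blast
    qed
    show "trans (rat_conj L K G H)"
    proof (rule transI)
      fix \<phi> \<psi> \<chi> assume a: "(\<phi>, \<psi>) \<in> rat_conj L K G H" "(\<psi>, \<chi>) \<in> rat_conj L K G H"
      then obtain f g h where "f \<in> twists" "\<phi> = twisted_incl f" "g \<in> twists" "\<psi> = twisted_incl g"
        "h \<in> twists" "\<chi> = twisted_incl h"
        using sub unfolding conj_embeddings_eq by blast
      then show "(\<phi>, \<chi>) \<in> rat_conj L K G H"
        using a iff transD[OF E(3)] by blast
    qed
  qed
qed

lemma Emb_eq: "Emb L K G H = (\<lambda>g. rat_conj L K G H `` {twisted_incl g}) ` twists"
  unfolding Emb_def quotient_def conj_embeddings_eq by blast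

lemma incl_eq_twisted_incl_one: "(\<lambda>h\<in>H. h) = twisted_incl \<one>\<^bsub>GL\<^esub>"
  by (rule conj_unique[OF one_twists])
    (auto simp: is_conjugate_of_incl_def H_GK)

text \<open>The compatibility with coboundaries in the theorem amounts to sending the class of the coboundary of
  each twist \<open>g\<close> to the class of \<open>twisted_incl g\<close>, since \<open>g\<close> determines the embedding \<open>g i g\<^sup>-\<^sup>1\<close>. So \<open>unique_bijection_through\<close> applies to the two class maps on twists.\<close>

lemma kernel_correspondence:
  "(\<forall>c\<in>kerH1 L K G H. \<exists>g\<in>carrier GL. cob g \<in> c) \<and>
    (\<exists>!\<Phi>. \<Phi> \<in> extensional (kerH1 L K G H) \<and>
       pointed_iso \<Phi> (kerH1 L K G H) (kerH1_base L K G H) (Emb L K G H) (Emb_base L K G H) \<and>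
       (\<forall>c\<in>kerH1 L K G H. \<forall>g\<in>carrier GL. cob g \<in> c \<longrightarrow> (\<exists>\<phi>\<in>\<Phi> c. is_conj g \<phi>)))"
proof
  let ?p = "\<lambda>g. cohZ `` {cob g}" and ?q = "\<lambda>g. rat_conj L K G H `` {twisted_incl g}"
  have cocZ: "cob g \<in> cocZ" if "g \<in> twists" for g
    using cob_cocZ_iff[OF twistsD(1)[OF that]] that by simp
  have emb: "twisted_incl g \<in> conj_embeddings L K G H" if "g \<in> twists" for g
    using that conj_embeddings_eq by blast
  have self: "cob g \<in> ?p g" "twisted_incl g \<in> ?q g" if "g \<in> twists" for g
    using equiv_class_self[OF equiv_cohZ cocZ[OF that]]
      equiv_class_self[OF equiv_rat_conj emb[OF that]] .
  show "\<forall>c\<in>kerH1 L K G H. \<exists>g\<in>carrier GL. cob g \<in> c"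
    unfolding kerH1_eq using self(1) twistsD(1) by blast
  have fibres: "?p g = ?p g' \<longleftrightarrow> ?q g = ?q g'" if "g \<in> twists" "g' \<in> twists" for g g'
    using eq_equiv_class_iff[OF equiv_cohZ cocZ[OF that(1)] cocZ[OF that(2)]]
      eq_equiv_class_iff[OF equiv_rat_conj emb[OF that(1)] emb[OF that(2)]]
      rat_conj_iff[OF that] cohZ_cob_iff[OF that] by simp
  have bases: "kerH1_base L K G H = ?p \<one>\<^bsub>GL\<^esub>" "Emb_base L K G H = ?q \<one>\<^bsub>GL\<^esub>"
    by (simp_all add: kerH1_base_def H1_base_def cob_one Emb_base_def incl_eq_twisted_incl_one)
  have "(\<forall>c\<in>kerH1 L K G H. \<forall>g\<in>carrier GL. cob g \<in> c \<longrightarrow> (\<exists>\<phi>\<in>\<Phi> c. is_conj g \<phi>)) \<longleftrightarrow>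
      (\<forall>g\<in>twists. \<Phi> (?p g) = ?q g)"
    if \<Phi>: "pointed_iso \<Phi> (kerH1 L K G H) (kerH1_base L K G H) (Emb L K G H) (Emb_base L K G H)" for \<Phi>
  proof
    assume compat: "\<forall>c\<in>kerH1 L K G H. \<forall>g\<in>carrier GL. cob g \<in> c \<longrightarrow> (\<exists>\<phi>\<in>\<Phi> c. is_conj g \<phi>)"
    show "\<forall>g\<in>twists. \<Phi> (?p g) = ?q g"
    proof
      fix g assume g: "g \<in> twists"
      have pg: "?p g \<in> kerH1 L K G H" unfolding kerH1_eq using g by blast
      then obtain \<phi> where \<phi>: "\<phi> \<in> \<Phi> (?p g)" "is_conj g \<phi>"
        using compat self(1)[OF g] twistsD(1)[OF g] by blast
      have "\<Phi> (?p g) \<in> Emb L K G H"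
        using \<Phi> pg unfolding pointed_iso_def bij_betw_def by blast
      then obtain g' where g': "g' \<in> twists" "\<Phi> (?p g) = ?q g'"
        unfolding Emb_eq by blast
      have rel: "(twisted_incl g', \<phi>) \<in> rat_conj L K G H"
        using \<phi>(1) g'(2) by simp
      then have "\<phi> \<in> H \<rightarrow> carrier GK" "\<phi> \<in> extensional H"
        unfolding rat_conj_def conj_embeddings_def by (auto simp: hom_def)
      then have "\<phi> = twisted_incl g"
        using conj_unique[OF g] \<phi>(2) by blast
      then show "\<Phi> (?p g) = ?q g"
        using rel g'(2) equiv_class_eq[OF equiv_rat_conj] by simp
    qed
  next
    assume compat: "\<forall>g\<in>twists. \<Phi> (?p g) = ?q g"
    show "\<forall>c\<in>kerH1 L K G H. \<forall>g\<in>carrier GL. cob g \<in> c \<longrightarrow> (\<exists>\<phi>\<in>\<Phi> c. is_conj g \<phi>)"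
    proof (intro ballI impI)
      fix c g assume c: "c \<in> kerH1 L K G H" and g: "g \<in> carrier GL" and gc: "cob g \<in> c"
      obtain g' where g': "g' \<in> twists" "c = ?p g'"
        using c unfolding kerH1_eq by blast
      have rel: "(cob g', cob g) \<in> cohZ"
        using gc g'(2) by simp
      then have tw: "g \<in> twists"
        using cob_cocZ_iff[OF g] unfolding cohomologous_def by blast
      have "c = ?p g"
        using equiv_class_eq[OF equiv_cohZ rel] g'(2) by simp
      then show "\<exists>\<phi>\<in>\<Phi> c. is_conj g \<phi>"
        using compat tw self(2)[OF tw] twisted_incl(2)[OF tw] by auto
    qed
  qed
  then have iff: "(\<Phi> \<in> extensional (kerH1 L K G H) \<and>
       pointed_iso \<Phi> (kerH1 L K G H) (kerH1_base L K G H) (Emb L K G H) (Emb_base L K G H) \<and>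
       (\<forall>c\<in>kerH1 L K G H. \<forall>g\<in>carrier GL. cob g \<in> c \<longrightarrow> (\<exists>\<phi>\<in>\<Phi> c. is_conj g \<phi>))) \<longleftrightarrow>
      (\<Phi> \<in> extensional (kerH1 L K G H) \<and>
       pointed_iso \<Phi> (kerH1 L K G H) (?p \<one>\<^bsub>GL\<^esub>) (Emb L K G H) (?q \<one>\<^bsub>GL\<^esub>) \<and>
       (\<forall>g\<in>twists. \<Phi> (?p g) = ?q g))" for \<Phi>
    unfolding bases by blast
  show "\<exists>!\<Phi>. \<Phi> \<in> extensional (kerH1 L K G H) \<and>
       pointed_iso \<Phi> (kerH1 L K G H) (kerH1_base L K G H) (Emb L K G H) (Emb_base L K G H) \<and>
       (\<forall>c\<in>kerH1 L K G H. \<forall>g\<in>carrier GL. cob g \<in> c \<longrightarrow> (\<exists>\<phi>\<in>\<Phi> c. is_conj g \<phi>))"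
    unfolding iff
    using unique_bijection_through[OF kerH1_eq[symmetric] Emb_eq[symmetric] one_twists fibres] by blast
qed

end

theorem proposition2p2:
  fixes Ks :: "'a ring" and K :: "'a set"
    and G :: "('a, 'a, 'g) alg_functor" and H :: "'g set"
  assumes "separable_closure Ks K"
    and "algebraic_group (Ks\<lparr>carrier := K\<rparr>) G"
    and "subgroup H (rat_points Ks K G)"
  shows "(\<forall>c\<in>kerH1 Ks K G H. \<exists>g\<in>carrier (sep_points Ks G). coboundary Ks K G g \<in> c) \<and>
    (\<exists>!\<Phi>. \<Phi> \<in> extensional (kerH1 Ks K G H) \<and>
       pointed_iso \<Phi> (kerH1 Ks K G H) (kerH1_base Ks K G H) (Emb Ks K G H) (Emb_base Ks K G H) \<and>
       (\<forall>c\<in>kerH1 Ks K G H. \<forall>g\<in>carrier (sep_points Ks G). coboundary Ks K G g \<in> c \<longrightarrow>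
          (\<exists>\<phi>\<in>\<Phi> c. is_conjugate_of_incl Ks K G H g \<phi>)))"
proof -
  interpret subgroup_of_rational_points Ks K G H
    by (intro subgroup_of_rational_points.intro algebraic_group_over_sep_closure.intro
        algebraic_group_over_sep_closure_axioms.intro subgroup_of_rational_points_axioms.intro assms)
  show ?thesis by (rule kernel_correspondence)
qed

end
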